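(* Let $u_1,u_2\in\mathbb{R}^{2,1}$ be a pair of consistently oriented spacelike vectors, let $o=(0,0,0)$, and let $(z_1,z_2),(z_1',z_2')\in AP(u_1,u_2)$ be allowable pairs. Then the two crooked surfaces $$\rho\,\tau_{z_1'}\,\rho\left(\overline{\mathcal{C}(o+z_1,u_1)}^{\mathrm{conf}}\right)\quad\text{and}\quad \rho\,\tau_{z_2'}\,\rho\left(\overline{\mathcal{C}(o+z_2,u_2)}^{\mathrm{conf}}\right)$$ in $\mathrm{Ein}_3$ are disjoint.
   Context: Einstein Universe. $\mathbb{R}^{3,2}$ is $\mathbb{R}^5$ with $\langle x,y\rangle=x_1y_1+x_2y_2+x_3y_3-x_4y_4-x_5y_5$; $\mathcal{N}^{3,2}$ is the set of nonzero $x$ with $\langle x,x\rangle=0$; $\mathrm{Ein}_3=\mathcal{N}^{3,2}/\mathbb{R}^*$, with projection $\pi$, and $\pi(v)$ is written $(v_1:\dots:v_5)$. A photon is $\pi(W\setminus\{0\})$ for $W\subset\mathbb{R}^{3,2}$ a totally isotropic plane. $\mathbb{R}^{2,1}$ is $\mathbb{R}^3$ with its standard orientation, the Lorentzian product $v\cdot w=v_1w_1+v_2w_2-v_3w_3$, and future-pointing meaning $v_3>0$ (for nonzero null or timelike $v$); a vector is spacelike, null or timelike according to whether $v\cdot v$ is $>0$, $=0$ or $<0$. The affine space modeled on $\mathbb{R}^{2,1}$ is identified with $\mathbb{R}^{2,1}$ via the origin $(0,0,0)$. The embedding $\iota:\mathbb{R}^{2,1}\to\mathrm{Ein}_3$ is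 $\iota(v)=\left(\frac{1-v\cdot v}{2}:v:\frac{1+v\cdot v}{2}\right)$. Set $p_\infty=(-1:0:0:0:1)$. Crooked planes. For $u\in\mathbb{R}^{2,1}$ spacelike, $u^-,u^+$ denote future-pointing null vectors in $u^\perp$ (each determined up to positive scaling) such that $(u,u^-,u^+)$ is a positively oriented basis. For a future-pointing null vector $x$, the positive linear wing $\mathsf{W}(x)$ is the closure of the open halfplane of those spacelike $u\in x^\perp$ for which $x$ is a positive multiple of $u^+$. The linear stem is $\mathsf{Stem}(u)=\{x\in u^\perp : x\cdot x\le 0\}$. The crooked plane with vertex $p$ and director $u$ is $\mathcal{C}(p,u)=p+\big(\mathsf{Stem}(u)\cup\mathsf{W}(u^+)\cup\mathsf{W}(u^-)\big)$. The stem quadrant is $\mathsf{Quad}(p,u)=p+\{a u^--b u^+ : a,b\ge 0\}$. The crooked halfspace $\mathcal{H}(p,u)$ is the component of the complement of $\mathcal{C}(p,u)$ containing the relative interior of $\mathsf{Quad}(p,u)$. Consistently oriented: spacelike $u_1,u_2$ are consistently oriented if the closures of $\mathcal{H}(o,u_1)$ and $\mathcal{H}(o,u_2)$ intersect only in $o$. Allowable pairs: for $u_1,u_2$ consistently oriented, $AP(u_1,u_2)$ is the set of $(z_1,z_2)$ with $z_i\in\mathsf{Quad}(o,u_i)-o$ for $i=1,2$ and $z_1-z_2$ in the interior (in $\mathbb{R}^{2,1}$) of the set of differences $\mathsf{Quad}(o,u_1)-\mathsf{Quad}(o,u_2)=\{a-b: a\in\mathsf{Quad}(o,u_1),\,b\in\mathsf{Quad}(o,u_2)\}$.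 Compactification: $\overline{\mathcal{C}(p,u)}^{\mathrm{conf}}=\iota(\mathcal{C}(p,u))\cup\phi_\infty\cup\psi_\infty$, where $\phi_\infty$ (resp. $\psi_\infty$) is the photon containing $p_\infty$ and $(0:u^+:0)$ (resp. $p_\infty$ and $(0:u^-:0)$). A crooked surface is any image of such a set (for $o$ and some spacelike $u$) under an element of $\mathrm{SO}(3,2)$. Maps. $\rho:\mathrm{Ein}_3\to\mathrm{Ein}_3$ is $\rho(v_1:v_2:v_3:v_4:v_5)=(-v_1:v_2:v_3:v_4:v_5)$. For $v\in\mathbb{R}^{2,1}$, $\tau_v$ is the automorphism of $\mathrm{Ein}_3$, induced by a linear isometry of $\mathbb{R}^{3,2}$, that fixes $p_\infty$ and satisfies $\tau_v(\iota(x))=\iota(x+v)$ for all $x\in\mathbb{R}^{2,1}$. *)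

theory Defs
  imports "HOL-Analysis.Analysis"
begin

lemma exhaust_5: "x = 1 \<or> x = 2 \<or> x = 3 \<or> x = 4 \<or> x = 5" for x :: 5
proof (induct x)
  case (of_int z)
  then have "z = 0 \<or> z = 1 \<or> z = 2 \<or> z = 3 \<or> z = 4" by fastforce
  then show ?case by auto
qed

lemma forall_5: "(\<forall>i::5. P i) \<longleftrightarrow> P 1 \<and> P 2 \<and> P 3 \<and> P 4 \<and> P 5"
  by (metis exhaust_5)

lemma vector_5:
  "(vector [a, b, c, d, e] :: ('a::zero)^5) $ 1 = a"
  "(vector [a, b, c, d, e] :: ('a::zero)^5) $ 2 = b"
  "(vector [a, b, c, d, e] :: ('a::zero)^5) $ 3 = c"
  "(vector [a, b, c, d, e] :: ('a::zero)^5) $ 4 = d"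
  "(vector [a, b, c, d, e] :: ('a::zero)^5) $ 5 = e"
  unfolding vector_def by simp_all


section \<open>The Einstein universe\<close>

definition form32 :: "real^5 \<Rightarrow> real^5 \<Rightarrow> real" where
  "form32 x y = x$1 * y$1 + x$2 * y$2 + x$3 * y$3 - x$4 * y$4 - x$5 * y$5"

definition null_cone32 :: "(real^5) set" where
  "null_cone32 = {x. x \<noteq> 0 \<and> form32 x x = 0}"

definition ein_rel :: "real^5 \<Rightarrow> real^5 \<Rightarrow> bool" where
  "ein_rel x y \<longleftrightarrow> x \<in> null_cone32 \<and> y \<in> null_cone32 \<and> (\<exists>t. t \<noteq> 0 \<and> y = t *\<^sub>R x)"

lemma part_equivp_ein_rel: "part_equivp ein_rel"
proof (rule part_equivpI)
  have "vector [1, 0, 0, 0, 1] \<in> null_cone32"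
    by (simp add: null_cone32_def form32_def vec_eq_iff forall_5 vector_5)
  then show "\<exists>x. ein_rel x x"
    unfolding ein_rel_def by (metis scaleR_one zero_neq_one)
  show "symp ein_rel"
  proof (rule sympI)
    fix x y assume "ein_rel x y"
    then obtain t where t: "x \<in> null_cone32" "y \<in> null_cone32" "t \<noteq> 0" "y = t *\<^sub>R x"
      by (auto simp: ein_rel_def)
    then have "x = inverse t *\<^sub>R y" by simp
    with t show "ein_rel y x"
      unfolding ein_rel_def by (metis nonzero_imp_inverse_nonzero)
  qed
  show "transp ein_rel"
  proof (rule transpI)
    fix x y z assume "ein_rel x y" "ein_rel y z"
    then obtain s t where "x \<in> null_cone32" "z \<in> null_cone32" "s \<noteq> 0" "t \<noteq> 0" "z = t *\<^sub>R s *\<^sub>R x"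
      by (auto simp: ein_rel_def)
    then show "ein_rel x z"
      unfolding ein_rel_def by (metis mult_eq_0_iff scaleR_scaleR)
  qed
qed

quotient_type ein3 = "real^5" / partial: ein_rel
  by (rule part_equivp_ein_rel)

text \<open>The projection is meaningful only on \<^term>\<open>null_cone32\<close>.\<close>

definition ein_proj :: "real^5 \<Rightarrow> ein3" where
  "ein_proj = abs_ein3"

definition photon :: "ein3 set \<Rightarrow> bool" where
  "photon F \<longleftrightarrow> (\<exists>W. subspace W \<and> dim W = 2 \<and> (\<forall>x\<in>W. \<forall>y\<in>W. form32 x y = 0)
                    \<and> F = ein_proj ` (W - {0}))"

definition photon_through :: "ein3 \<Rightarrow> ein3 \<Rightarrow> ein3 set" where
  "photon_through p q = (THE F. photon F \<and> p \<in> F \<and> q \<in> F)"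

definition O32 :: "(real^5^5) set" where
  "O32 = {A. \<forall>x y. form32 (A *v x) (A *v y) = form32 x y}"

definition SO32 :: "(real^5^5) set" where
  "SO32 = {A \<in> O32. det A = 1}"

definition induces :: "real^5^5 \<Rightarrow> (ein3 \<Rightarrow> ein3) \<Rightarrow> bool" where
  "induces A f \<longleftrightarrow> (\<forall>x\<in>null_cone32. f (ein_proj x) = ein_proj (A *v x))"


section \<open>Minkowski space and its conformal embedding\<close>

definition lor :: "real^3 \<Rightarrow> real^3 \<Rightarrow> real" where
  "lor v w = v$1 * w$1 + v$2 * w$2 - v$3 * w$3"

definition spacelike :: "real^3 \<Rightarrow> bool" where
  "spacelike v \<longleftrightarrow> lor v v > 0"

definition future_null :: "real^3 \<Rightarrow> bool" where
  "future_null v \<longleftrightarrow> lor v v = 0 \<and> v$3 > 0"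

definition embed5 :: "real \<Rightarrow> real^3 \<Rightarrow> real \<Rightarrow> real^5" where
  "embed5 a v b = vector [a, v$1, v$2, v$3, b]"

definition ein_iota :: "real^3 \<Rightarrow> ein3" where
  "ein_iota v = ein_proj (embed5 ((1 - lor v v) / 2) v ((1 + lor v v) / 2))"

definition p_infty :: ein3 where
  "p_infty = ein_proj (embed5 (-1) 0 1)"


section \<open>Crooked planes and crooked halfspaces\<close>

definition null_frame :: "real^3 \<Rightarrow> real^3 \<Rightarrow> real^3 \<Rightarrow> bool" where
  "null_frame u x y \<longleftrightarrow> future_null x \<and> future_null y \<and> lor u x = 0 \<and> lor u y = 0
                         \<and> det (vector [u, x, y] :: real^3^3) > 0"

text \<open>For spacelike \<open>u\<close>, the two null vectors \<open>u\<^sup>-\<close> and \<open>u\<^sup>+\<close> are determined up to positive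
  scaling; we fix one choice. Everything below is independent of it.\<close>

definition u_minus :: "real^3 \<Rightarrow> real^3" where
  "u_minus u = (SOME x. \<exists>y. null_frame u x y)"

definition u_plus :: "real^3 \<Rightarrow> real^3" where
  "u_plus u = (SOME y. null_frame u (u_minus u) y)"

definition wing :: "real^3 \<Rightarrow> (real^3) set" where
  "wing x = closure {u. spacelike u \<and> lor u x = 0 \<and> (\<exists>t>0. x = t *\<^sub>R u_plus u)}"

definition stem :: "real^3 \<Rightarrow> (real^3) set" where
  "stem u = {x. lor x u = 0 \<and> lor x x \<le> 0}"

definition crooked_plane :: "real^3 \<Rightarrow> real^3 \<Rightarrow> (real^3) set" where
  "crooked_plane p u = (+) p ` (stem u \<union> wing (u_plus u) \<union> wing (u_minus u))"

definition stem_quadrant :: "real^3 \<Rightarrow> real^3 \<Rightarrow> (real^3) set" where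
  "stem_quadrant p u = (+) p ` {a *\<^sub>R u_minus u - b *\<^sub>R u_plus u | a b. a \<ge> 0 \<and> b \<ge> 0}"

definition crooked_halfspace :: "real^3 \<Rightarrow> real^3 \<Rightarrow> (real^3) set" where
  "crooked_halfspace p u =
     (THE H. H \<in> components (- crooked_plane p u) \<and> rel_interior (stem_quadrant p u) \<subseteq> H)"

definition consistently_oriented :: "real^3 \<Rightarrow> real^3 \<Rightarrow> bool" where
  "consistently_oriented u\<^sub>1 u\<^sub>2 \<longleftrightarrow>
     closure (crooked_halfspace 0 u\<^sub>1) \<inter> closure (crooked_halfspace 0 u\<^sub>2) = {0}"

text \<open>Translating \<open>Quad(o, u)\<close> by the origin, which turns points into vectors, is the identity
  here. In particular the zero vector is not excluded as a component of a pair.\<close>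

definition allowable_pairs :: "real^3 \<Rightarrow> real^3 \<Rightarrow> ((real^3) \<times> (real^3)) set" where
  "allowable_pairs u\<^sub>1 u\<^sub>2 =
     {(z\<^sub>1, z\<^sub>2). z\<^sub>1 \<in> stem_quadrant 0 u\<^sub>1 \<and> z\<^sub>2 \<in> stem_quadrant 0 u\<^sub>2 \<and>
        z\<^sub>1 - z\<^sub>2 \<in> interior {a - b | a b. a \<in> stem_quadrant 0 u\<^sub>1 \<and> b \<in> stem_quadrant 0 u\<^sub>2}}"


section \<open>Crooked surfaces\<close>

definition crooked_plane_conf :: "real^3 \<Rightarrow> real^3 \<Rightarrow> ein3 set" where
  "crooked_plane_conf p u = ein_iota ` crooked_plane p u
     \<union> photon_through p_infty (ein_proj (embed5 0 (u_plus u) 0))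
     \<union> photon_through p_infty (ein_proj (embed5 0 (u_minus u) 0))"

definition crooked_surface :: "ein3 set \<Rightarrow> bool" where
  "crooked_surface S \<longleftrightarrow>
     (\<exists>A\<in>SO32. \<exists>f u. induces A f \<and> spacelike u \<and> S = f ` crooked_plane_conf 0 u)"

lift_definition ein_rho :: "ein3 \<Rightarrow> ein3"
  is "\<lambda>v. vector [- v$1, v$2, v$3, v$4, v$5]"
  by (auto simp: ein_rel_def null_cone32_def form32_def vec_eq_iff forall_5 vector_5)

text \<open>The conditions determine \<open>\<tau>\<^sub>v\<close> uniquely, since the projective classes of \<open>p\<^sub>\<infinity>\<close> and of
  the \<open>\<iota>(x)\<close> contain a projective frame.\<close>

definition ein_tau :: "real^3 \<Rightarrow> ein3 \<Rightarrow> ein3" where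
  "ein_tau v = (THE f. (\<exists>A\<in>O32. induces A f) \<and> f p_infty = p_infty \<and>
                       (\<forall>x. f (ein_iota x) = ein_iota (x + v)))"

end

theory Submission
  imports Defs
begin

text \<open>Let \<open>K\<^sub>i\<close> be the closed crooked halfspace of \<open>u\<^sub>i\<close>, completed at infinity by the null
  directions it contains. It contains the conformal closure of \<open>\<C>(o, u\<^sub>i)\<close> and is preserved by \<open>\<rho>\<close>
  and by the translations \<open>T\<^sub>i\<close>, \<open>T\<^sub>i'\<close> along \<open>z\<^sub>i\<close>, \<open>z\<^sub>i'\<close>. Allowability makes \<open>T\<^sub>1 K\<^sub>1\<close> and \<open>T\<^sub>2 K\<^sub>2\<close> meet
  only in \<open>p\<^sub>\<infinity>\<close>: a common point in Minkowski space lies in both halfspaces, so it is \<open>o\<close>; then each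
  \<open>- z\<^sub>i\<close> is in its halfspace, so \<open>z\<^sub>i\<close> is on an edge of its quadrant, and the cyclic order of the four
  null directions puts \<open>z\<^sub>1 - z\<^sub>2\<close> on the boundary of the set of differences. The same holds for \<open>T\<^sub>i'\<close>.
  If \<open>\<rho> T\<^sub>1' \<rho> T\<^sub>1 x\<^sub>1 = \<rho> T\<^sub>2' \<rho> T\<^sub>2 x\<^sub>2\<close> with \<open>x\<^sub>i\<close> in \<open>K\<^sub>i\<close>, then \<open>\<rho> T\<^sub>i x\<^sub>i\<close> is in \<open>K\<^sub>i\<close> and therefore equals
  \<open>p\<^sub>\<infinity>\<close>, that is, \<open>T\<^sub>1 x\<^sub>1 = T\<^sub>2 x\<^sub>2 = o\<close>. This is a second common point of \<open>T\<^sub>1 K\<^sub>1\<close> and \<open>T\<^sub>2 K\<^sub>2\<close>.\<close>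

section \<open>Null frames\<close>

lemma lor_bilinear [simp]:
  "lor (x + y) z = lor x z + lor y z" "lor z (x + y) = lor z x + lor z y"
  "lor (x - y) z = lor x z - lor y z" "lor z (x - y) = lor z x - lor z y"
  "lor (c *\<^sub>R x) z = c * lor x z" "lor z (c *\<^sub>R x) = c * lor z x"
  "lor (- x) z = - lor x z" "lor z (- x) = - lor z x"
  "lor 0 z = 0" "lor z 0 = 0"
  by (simp_all add: lor_def algebra_simps)

lemma lor_commute: "lor x y = lor y x"
  by (simp add: lor_def mult.commute)

lemma continuous_on_lor [continuous_intros]: "continuous_on S (\<lambda>v. lor v w)"
  unfolding lor_def by (intro continuous_intros)

lemma det_rows:
  "det (vector [u, x, y] :: real^3^3) =
     u$1 * x$2 * y$3 + u$2 * x$3 * y$1 + u$3 * x$1 * y$2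
     - u$1 * x$3 * y$2 - u$2 * x$1 * y$3 - u$3 * x$2 * y$1"
  by (simp add: det_3 vector_3)

text \<open>Determinant of the projections to the first two coordinates. For \<open>w\<close>
  orthogonal to a future null \<open>y\<close>, its sign tells on which side of the line of
  \<open>y\<close> the vector \<open>w\<close> lies in that null plane.\<close>

definition planar :: "real^3 \<Rightarrow> real^3 \<Rightarrow> real" where
  "planar w y = w$1 * y$2 - w$2 * y$1"

lemma planar_simps [simp]:
  "planar (x + y) z = planar x z + planar y z" "planar (c *\<^sub>R x) z = c * planar x z"
  "planar z (c *\<^sub>R x) = c * planar z x" "planar z z = 0"
  by (simp_all add: planar_def algebra_simps)

lemma continuous_on_planar [continuous_intros]: "continuous_on S (\<lambda>w. planar w y)"
  unfolding planar_def by (intro continuous_intros)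

text \<open>Cauchy-Schwarz in the first two coordinates, where nullity turns the two norms into
  \<open>x$3\<close> and \<open>y$3\<close>.\<close>

lemma future_null_lor_nonpos:
  assumes "future_null x" "future_null y"
  shows "lor x y \<le> 0"
proof -
  have x: "x$1 * x$1 + x$2 * x$2 = x$3 * x$3" "x$3 > 0"
    and y: "y$1 * y$1 + y$2 * y$2 = y$3 * y$3" "y$3 > 0"
    using assms by (auto simp: future_null_def lor_def)
  have "(x$1 * y$1 + x$2 * y$2)\<^sup>2 \<le> (x$1 * x$1 + x$2 * x$2) * (y$1 * y$1 + y$2 * y$2)"
    using sum_squares_ge_zero[of "x$1 * y$2 - x$2 * y$1" 0]
    by (simp add: power2_eq_square algebra_simps)
  also have "\<dots> = (x$3 * y$3)\<^sup>2"
    unfolding x y by (simp add: power2_eq_square)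
  finally have "x$1 * y$1 + x$2 * y$2 \<le> x$3 * y$3"
    by (rule power2_le_imp_le) (use x y in simp)
  then show ?thesis by (simp add: lor_def)
qed

text \<open>The Lorentzian cross product of \<open>u\<close> and \<open>y\<close> is a multiple of \<open>y\<close>, and the planar
  determinant is its last component.\<close>

lemma det_null_planar:
  assumes "lor u y = 0" "lor y y = 0"
  shows "det (vector [u, x, y] :: real^3^3) * y$3 = lor x y * planar u y"
  using assms unfolding det_rows planar_def lor_def by algebra

lemma det_swap:
  "det (vector [u, x, y] :: real^3^3) = - det (vector [u, y, x] :: real^3^3)"
  by (simp add: det_rows)

text \<open>By \<open>det_null_planar\<close>, positive orientation makes
  \<open>lor x y * planar u y\<close> positive. So \<open>lor x y\<close> is nonzero, hence
  negative, and the planar signs follow.\<close>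

lemma null_frameD:
  assumes "null_frame u x y"
  shows "lor u x = 0" "lor u y = 0" "lor x u = 0" "lor y u = 0" "lor x x = 0" "lor y y = 0"
    "x$3 > 0" "y$3 > 0" "lor x y < 0" "lor y x < 0" "planar u y < 0" "planar u x > 0"
proof -
  show *: "lor u x = 0" "lor u y = 0" "lor x u = 0" "lor y u = 0" "lor x x = 0" "lor y y = 0"
    "x$3 > 0" "y$3 > 0"
    using assms by (auto simp: null_frame_def future_null_def lor_commute)
  have d: "det (vector [u, x, y] :: real^3^3) > 0" and "lor x y \<le> 0"
    using assms future_null_lor_nonpos by (auto simp: null_frame_def)
  have p: "lor x y * planar u y > 0"
    using det_null_planar[of u y x] d * by (metis mult_pos_pos)
  then show "lor x y < 0"
    using \<open>lor x y \<le> 0\<close> by (cases "lor x y = 0") auto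
  then show "planar u y < 0" "lor y x < 0"
    using p by (auto simp: zero_less_mult_iff lor_commute)
  have "- (lor y x * planar u x) > 0"
    using det_null_planar[of u x y] d * det_swap[of u x y] mult_pos_pos[OF d \<open>x$3 > 0\<close>] by simp
  then show "planar u x > 0"
    using \<open>lor y x < 0\<close> by (simp add: mult_less_0_iff)
qed

lemma null_frame_decompose:
  assumes "null_frame u x y" "spacelike u"
  shows "v = (lor v y / lor x y) *\<^sub>R x + (lor v x / lor x y) *\<^sub>R y + (lor v u / lor u u) *\<^sub>R u"
proof -
  note f = null_frameD[OF assms(1)]
  have u: "lor u u > 0" using assms(2) by (simp add: spacelike_def)
  define d where
    "d = v - ((lor v y / lor x y) *\<^sub>R x + (lor v x / lor x y) *\<^sub>R y + (lor v u / lor u u) *\<^sub>R u)"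
  have "lor d u = 0" "lor d x = 0" "lor d y = 0"
    using f u by (auto simp: d_def lor_commute[of y x])
  \<comment> \<open>Cramer's rule: \<open>d\<close> solves a homogeneous linear system whose
    determinant is, up to sign, that of the frame.\<close>
  then have "det (vector [u, x, y] :: real^3^3) * d$1 = 0"
      "det (vector [u, x, y] :: real^3^3) * d$2 = 0"
      "det (vector [u, x, y] :: real^3^3) * d$3 = 0"
    unfolding det_rows lor_def by algebra+
  moreover have "det (vector [u, x, y] :: real^3^3) > 0"
    using assms(1) by (simp add: null_frame_def)
  ultimately have "d = 0" by (simp add: vec_eq_iff forall_3)
  then show ?thesis by (simp add: d_def)
qed

lemma null_frame_lor_self:
  assumes "null_frame u x y" "spacelike u"
  shows "lor v v = 2 * (lor v x * lor v y) / lor x y + (lor v u)\<^sup>2 / lor u u"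
proof -
  have "lor v v = lor v ((lor v y / lor x y) *\<^sub>R x + (lor v x / lor x y) *\<^sub>R y
      + (lor v u / lor u u) *\<^sub>R u)"
    using null_frame_decompose[OF assms, of v] by simp
  then show ?thesis by (simp add: power2_eq_square mult.commute)
qed

lemma ex_null_frame:
  assumes "spacelike u"
  shows "\<exists>x y. null_frame u x y"
proof -
  define n where "n = u$1 * u$1 + u$2 * u$2"
  define m where "m = sqrt (n - u$3 * u$3)"
  have nm: "n - u$3 * u$3 > 0" using assms by (simp add: spacelike_def lor_def n_def)
  then have "m > 0" and m2: "m * m = n - u$3 * u$3" by (simp_all add: m_def)
  have "n > 0" using nm zero_le_square[of "u$3"] by linarith
  \<comment> \<open>At height \<open>n\<close>, orthogonality to \<open>u\<close> fixes the
    horizontal component along \<open>u\<close>, and nullity fixes the length of the perpendicular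
    one. Its two signs give \<open>x\<close> and \<open>y\<close>.\<close>
  define x :: "real^3" where "x = vector [u$3 * u$1 - m * u$2, u$3 * u$2 + m * u$1, n]"
  define y :: "real^3" where "y = vector [u$3 * u$1 + m * u$2, u$3 * u$2 - m * u$1, n]"
  have null: "lor x x = 0" "lor y y = 0" "lor u x = 0" "lor u y = 0"
    using m2 unfolding lor_def x_def y_def vector_3 n_def by algebra+
  have "det (vector [u, x, y] :: real^3^3) = 2 * m * n * (n - u$3 * u$3)"
    unfolding det_rows x_def y_def vector_3 n_def by (simp add: algebra_simps)
  then have "det (vector [u, x, y] :: real^3^3) > 0"
    using \<open>m > 0\<close> \<open>n > 0\<close> nm by simp
  moreover have "x$3 > 0" "y$3 > 0" using \<open>n > 0\<close> by (simp_all add: x_def y_def vector_3)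
  ultimately show ?thesis using null by (auto simp: null_frame_def future_null_def)
qed

lemma null_frame_u:
  assumes "spacelike u"
  shows "null_frame u (u_minus u) (u_plus u)"
proof -
  have "\<exists>y. null_frame u (u_minus u) y"
    unfolding u_minus_def by (rule someI_ex) (rule ex_null_frame[OF assms])
  then show ?thesis
    unfolding u_plus_def by (rule someI_ex)
qed

lemmas u_frame = null_frameD[OF null_frame_u]

section \<open>Crooked planes and halfspaces in coordinates\<close>

lemma closure_if_ray:
  fixes v :: "'a::real_normed_vector"
  assumes "\<And>e. e > 0 \<Longrightarrow> v + e *\<^sub>R d \<in> S"
  shows "v \<in> closure S"
proof -
  have "(\<lambda>n. v + inverse (real (Suc n)) *\<^sub>R d) \<longlonglongrightarrow> v + 0 *\<^sub>R d"
    by (intro tendsto_intros LIMSEQ_inverse_real_of_nat)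
  then show ?thesis
    using assms unfolding closure_sequential by (intro exI[of _ "\<lambda>n. v + inverse (real (Suc n)) *\<^sub>R d"]) simp
qed

text \<open>In the frame of \<open>w\<close>, a null vector orthogonal to \<open>w\<close> has only
  one nonzero coordinate; the sign of \<open>planar\<close> tells the two null directions
  apart.\<close>

lemma future_null_parallel_u_plus:
  assumes "spacelike w" "future_null y" "lor w y = 0"
  shows "(\<exists>t>0. y = t *\<^sub>R u_plus w) \<longleftrightarrow> planar w y < 0"
proof
  note f = u_frame[OF assms(1)]
  assume "\<exists>t>0. y = t *\<^sub>R u_plus w"
  then show "planar w y < 0" using f by (auto simp: mult_less_0_iff)
next
  note f = u_frame[OF assms(1)]
  assume p: "planar w y < 0"
  define a where "a = lor y (u_plus w) / lor (u_minus w) (u_plus w)"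
  define b where "b = lor y (u_minus w) / lor (u_minus w) (u_plus w)"
  have y: "y = a *\<^sub>R u_minus w + b *\<^sub>R u_plus w"
    using null_frame_decompose[OF null_frame_u[OF assms(1)] assms(1), of y] assms(3)
    by (simp add: a_def b_def lor_commute)
  have "lor y y = 0" "y$3 > 0" using assms(2) by (auto simp: future_null_def)
  then have "a = 0 \<or> b = 0"
    using f unfolding y by (auto simp: lor_commute)
  moreover have "\<not> (a \<noteq> 0 \<and> b = 0)"
  proof
    assume "a \<noteq> 0 \<and> b = 0"
    then have "y = a *\<^sub>R u_minus w" using y by simp
    then show False using p f \<open>y$3 > 0\<close> by (auto simp: mult_less_0_iff zero_less_mult_iff)
  qed
  ultimately have "y = b *\<^sub>R u_plus w" using y by auto
  moreover from this have "b > 0" using f \<open>y$3 > 0\<close> by (auto simp: zero_less_mult_iff)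
  ultimately show "\<exists>t>0. y = t *\<^sub>R u_plus w" by blast
qed

text \<open>On the null plane of \<open>y\<close>, \<open>lor w w\<close> is a positive multiple of
  the square of \<open>planar w y\<close>, so every vector off the line of \<open>y\<close> is
  spacelike. The vector \<open>d\<close> pushes boundary points into the open halfplane.\<close>

lemma wing_eq:
  assumes y: "future_null y" and d: "spacelike d" "lor d y = 0" "planar d y < 0"
  shows "wing y = {w. lor w y = 0 \<and> planar w y \<le> 0}"
proof -
  have pos: "lor w w > 0" if "lor w y = 0" "planar w y < 0" for w
  proof -
    have "lor w w * (y$3)\<^sup>2 = (planar w y)\<^sup>2"
      using y that(1) unfolding planar_def lor_def future_null_def by algebra
    then show ?thesis using that(2) y
      by (metis future_null_def less_irrefl zero_less_power2 zero_less_mult_pos2)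
  qed
  have "{u. spacelike u \<and> lor u y = 0 \<and> (\<exists>t>0. y = t *\<^sub>R u_plus u)}
      = {w. lor w y = 0 \<and> planar w y < 0}"
    using pos y future_null_parallel_u_plus by (auto simp: spacelike_def)
  then have w: "wing y = closure {w. lor w y = 0 \<and> planar w y < 0}"
    by (simp add: wing_def)
  have "closed {w. lor w y = 0 \<and> planar w y \<le> 0}"
    by (intro closed_Collect_conj closed_Collect_eq closed_Collect_le continuous_intros)
  then have "wing y \<subseteq> {w. lor w y = 0 \<and> planar w y \<le> 0}"
    unfolding w by (intro closure_minimal) auto
  moreover have "v \<in> wing y" if "lor v y = 0 \<and> planar v y \<le> 0" for v
    unfolding w by (rule closure_if_ray[where d = d]) (use that d in \<open>auto simp: add_nonpos_neg mult_less_0_iff\<close>)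
  ultimately show ?thesis by blast
qed

lemma wing_u_plus:
  assumes "spacelike u"
  shows "wing (u_plus u) = {v. lor v (u_plus u) = 0 \<and> lor v u \<ge> 0}"
proof -
  note f = u_frame[OF assms]
  have uu: "lor u u > 0" using assms by (simp add: spacelike_def)
  have "planar v (u_plus u) \<le> 0 \<longleftrightarrow> lor v u \<ge> 0" if "lor v (u_plus u) = 0" for v
  proof -
    have "planar v (u_plus u) = lor v u / lor u u * planar u (u_plus u)"
      by (subst null_frame_decompose[OF null_frame_u[OF assms] assms, of v]) (simp add: that)
    then show ?thesis
      using f uu by (simp add: mult_le_0_iff zero_le_divide_iff divide_le_0_iff)
  qed
  moreover have "future_null (u_plus u)" using f by (simp add: future_null_def)
  ultimately show ?thesis
    using f assms by (subst wing_eq[where d = u]) auto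
qed

lemma wing_u_minus:
  assumes "spacelike u"
  shows "wing (u_minus u) = {v. lor v (u_minus u) = 0 \<and> lor v u \<le> 0}"
proof -
  note f = u_frame[OF assms]
  have uu: "lor u u > 0" using assms by (simp add: spacelike_def)
  have "planar v (u_minus u) \<le> 0 \<longleftrightarrow> lor v u \<le> 0" if "lor v (u_minus u) = 0" for v
  proof -
    have "planar v (u_minus u) = lor v u / lor u u * planar u (u_minus u)"
      by (subst null_frame_decompose[OF null_frame_u[OF assms] assms, of v]) (simp add: that)
    then show ?thesis
      using f uu by (simp add: mult_le_0_iff zero_le_divide_iff divide_le_0_iff)
  qed
  moreover have "future_null (u_minus u)" using f by (simp add: future_null_def)
  \<comment> \<open>The frame gives \<open>planar u (u_minus u)\<close> the opposite sign, so it is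
    \<open>- u\<close> that points into the open halfplane.\<close>
  moreover have "spacelike (- u)" "planar (- u) (u_minus u) < 0"
    using assms f by (auto simp: spacelike_def planar_def)
  ultimately show ?thesis
    using f by (subst wing_eq[where d = "- u"]) auto
qed

lemma stem_eq:
  assumes "spacelike u"
  shows "stem u = {v. lor v u = 0 \<and> 0 \<le> lor v (u_minus u) * lor v (u_plus u)}"
proof -
  note f = u_frame[OF assms]
  have "lor v v \<le> 0 \<longleftrightarrow> 0 \<le> lor v (u_minus u) * lor v (u_plus u)" if "lor v u = 0" for v
    using f that by (simp add: null_frame_lor_self[OF null_frame_u[OF assms] assms, of v] divide_le_0_iff)
  then show ?thesis by (auto simp: stem_def)
qed

section \<open>The crooked halfspace as a union of sign regions\<close>

definition side :: "real^3 \<Rightarrow> (real^3) set" where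
  "side u = {v. lor v u > 0 \<and> lor v (u_plus u) < 0} \<union> {v. lor v u < 0 \<and> lor v (u_minus u) > 0}
     \<union> {v. lor v (u_plus u) < 0 \<and> lor v (u_minus u) > 0}"

text \<open>With weak inequalities, the points where \<open>lor v (u_plus u) \<le> 0\<close> and
  \<open>lor v (u_minus u) \<ge> 0\<close> fall into one of these two pieces according to the sign
  of \<open>lor v u\<close>.\<close>

definition closed_side :: "real^3 \<Rightarrow> (real^3) set" where
  "closed_side u = {v. lor v u \<ge> 0 \<and> lor v (u_plus u) \<le> 0 \<or> lor v u \<le> 0 \<and> lor v (u_minus u) \<ge> 0}"

lemma open_side: "open (side u)"
  unfolding side_def
  by (intro open_Un open_Collect_conj open_Collect_less continuous_intros)

lemma convex_lor_pos: "convex {v. lor v a > 0}" and convex_lor_neg: "convex {v. lor v a < 0}"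
proof -
  have "lor v a = inner (vector [a$1, a$2, - (a$3)]) v" for v
    by (simp add: lor_def inner_vec_def sum_3 vector_3)
  then show "convex {v. lor v a > 0}" "convex {v. lor v a < 0}"
    by (simp_all add: convex_halfspace_gt convex_halfspace_lt)
qed

lemma stem_quadrant_zero:
  "stem_quadrant 0 u = {a *\<^sub>R u_minus u - b *\<^sub>R u_plus u | a b. a \<ge> 0 \<and> b \<ge> 0}"
  by (simp add: stem_quadrant_def)

lemma crooked_plane_zero_iff:
  assumes "spacelike u"
  shows "v \<in> crooked_plane 0 u \<longleftrightarrow>
    lor v u = 0 \<and> 0 \<le> lor v (u_minus u) * lor v (u_plus u)
    \<or> lor v (u_plus u) = 0 \<and> lor v u \<ge> 0 \<or> lor v (u_minus u) = 0 \<and> lor v u \<le> 0"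
  using assms by (auto simp: crooked_plane_def stem_eq wing_u_plus wing_u_minus)

text \<open>The other open set in a partition of the complement of the crooked plane.\<close>

definition opposite_side :: "real^3 \<Rightarrow> (real^3) set" where
  "opposite_side u = {v. lor v u > 0 \<and> lor v (u_plus u) > 0} \<union> {v. lor v u < 0 \<and> lor v (u_minus u) < 0}
     \<union> {v. lor v (u_plus u) > 0 \<and> lor v (u_minus u) < 0}"

lemma open_opposite_side: "open (opposite_side u)"
  unfolding opposite_side_def
  by (intro open_Un open_Collect_conj open_Collect_less continuous_intros)

lemma complement_crooked_plane:
  assumes "spacelike u"
  shows "- crooked_plane 0 u = side u \<union> opposite_side u" "side u \<inter> opposite_side u = {}"
proof -
  have "v \<notin> crooked_plane 0 u \<longleftrightarrow> v \<in> side u \<or> v \<in> opposite_side u" for v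
    unfolding crooked_plane_zero_iff[OF assms] side_def opposite_side_def zero_le_mult_iff
    by (simp, linarith)
  then show "- crooked_plane 0 u = side u \<union> opposite_side u" by blast
  show "side u \<inter> opposite_side u = {}" by (auto simp: side_def opposite_side_def)
qed

text \<open>The three pieces are convex, and the third meets each of the others.\<close>

lemma connected_side:
  assumes "spacelike u"
  shows "connected (side u)"
proof -
  note f = u_frame[OF assms]
  have uu: "lor u u > 0" using assms by (simp add: spacelike_def)
  let ?A = "{v. lor v u > 0 \<and> lor v (u_plus u) < 0}"
  let ?B = "{v. lor v u < 0 \<and> lor v (u_minus u) > 0}"
  let ?C = "{v. lor v (u_plus u) < 0 \<and> lor v (u_minus u) > 0}"
  have "convex ?A" "convex ?B" "convex ?C"
    by (simp_all add: Collect_conj_eq convex_Int convex_lor_pos convex_lor_neg)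
  moreover have "u_minus u - u_plus u + u \<in> ?A \<inter> ?C" "u_minus u - u_plus u - u \<in> ?B \<inter> ?C"
    using f uu by auto
  ultimately have "connected ?A" "connected ?B" "connected ?C"
    "?A \<inter> ?C \<noteq> {}" "?B \<inter> ?C \<noteq> {}" by (blast intro: convex_connected)+
  moreover from this have "connected (?A \<union> ?C)" by (intro connected_Un)
  moreover from calculation have "connected (?B \<union> ?C)" by (intro connected_Un)
  moreover from calculation have "(?A \<union> ?C) \<inter> (?B \<union> ?C) \<noteq> {}" by blast
  ultimately have "connected ((?A \<union> ?C) \<union> (?B \<union> ?C))" by (intro connected_Un)
  then show ?thesis by (simp add: side_def Un_ac)
qed

lemma rel_interior_stem_quadrant:
  assumes "spacelike u"
  shows "rel_interior (stem_quadrant 0 u) \<noteq> {}" "rel_interior (stem_quadrant 0 u) \<subseteq> side u"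
proof -
  note f = u_frame[OF assms]
  let ?Q = "stem_quadrant 0 u"
  have q: "lor z (u_plus u) \<le> 0 \<and> lor z (u_minus u) \<ge> 0" if "z \<in> ?Q" for z
    using that f by (auto simp: stem_quadrant_zero mult_nonneg_nonpos)
  have cone: "convex ?Q" unfolding convex_def
  proof (intro ballI allI impI)
    fix x y :: "real^3" and s t :: real
    assume "x \<in> ?Q" "y \<in> ?Q" and st: "0 \<le> s" "0 \<le> t"
    then obtain a b c d where "a \<ge> 0" "b \<ge> 0" "c \<ge> 0" "d \<ge> 0"
      "x = a *\<^sub>R u_minus u - b *\<^sub>R u_plus u" "y = c *\<^sub>R u_minus u - d *\<^sub>R u_plus u"
      by (auto simp: stem_quadrant_zero)
    with st have "s *\<^sub>R x + t *\<^sub>R y = (s * a + t * c) *\<^sub>R u_minus u - (s * b + t * d) *\<^sub>R u_plus u"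
      "0 \<le> s * a + t * c" "0 \<le> s * b + t * d"
      by (simp_all add: scaleR_diff_right scaleR_add_left)
    then show "s *\<^sub>R x + t *\<^sub>R y \<in> ?Q" unfolding stem_quadrant_zero by blast
  qed
  have in_Q: "u_minus u - u_plus u \<in> ?Q"
    unfolding stem_quadrant_zero by (auto intro!: exI[of _ 1])
  then show "rel_interior ?Q \<noteq> {}" using cone by (auto simp: rel_interior_eq_empty)
  show "rel_interior ?Q \<subseteq> side u"
  proof
    fix z assume "z \<in> rel_interior ?Q"
    \<comment> \<open>The segment from \<open>u_minus u - u_plus u\<close> to \<open>z\<close> can
      be prolonged beyond \<open>z\<close> within the quadrant, which makes the weak signs at
      \<open>z\<close> strict.\<close>
    then obtain e where e: "e > 1" "(1 - e) *\<^sub>R (u_minus u - u_plus u) + e *\<^sub>R z \<in> ?Q"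
      using convex_rel_interior_iff[OF cone, of z] in_Q by auto
    define k where "k = - lor (u_minus u) (u_plus u)"
    have k: "k > 0" "lor (u_minus u) (u_plus u) = - k" "lor (u_plus u) (u_minus u) = - k"
      using f by (auto simp: k_def lor_commute)
    have "e * k > k" using e k by simp
    moreover have "e * k + e * lor z (u_plus u) \<le> k" "e * k \<le> k + e * lor z (u_minus u)"
      using q[OF e(2)] f k by (auto simp: algebra_simps)
    ultimately have "e * lor z (u_plus u) < 0" "e * lor z (u_minus u) > 0" by linarith+
    then show "z \<in> side u"
      using e by (auto simp: side_def mult_less_0_iff zero_less_mult_iff)
  qed
qed

text \<open>A connected set that avoids the crooked plane and contains \<open>side u\<close> cannot
  meet \<open>opposite_side u\<close>. The quadrant has nonempty relative interior, so only one
  component can contain it.\<close>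

lemma crooked_halfspace_eq_side:
  assumes "spacelike u"
  shows "crooked_halfspace 0 u = side u"
proof -
  have nonempty: "side u \<noteq> {}" using rel_interior_stem_quadrant[OF assms] by blast
  have "side u \<in> components (- crooked_plane 0 u)"
    unfolding in_components_maximal
  proof (intro conjI allI impI)
    show "side u \<subseteq> - crooked_plane 0 u" using complement_crooked_plane[OF assms] by blast
    fix D assume D: "D \<noteq> {} \<and> side u \<subseteq> D \<and> D \<subseteq> - crooked_plane 0 u \<and> connected D"
    then have "side u \<inter> D = {} \<or> opposite_side u \<inter> D = {}"
      using complement_crooked_plane[OF assms]
      by (intro connectedD open_side open_opposite_side) auto
    then show "D = side u" using D nonempty complement_crooked_plane[OF assms] by blast
  qed (use nonempty connected_side[OF assms] in auto)
  then show ?thesis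
    unfolding crooked_halfspace_def
    using rel_interior_stem_quadrant[OF assms] components_nonoverlap
    by (intro the_equality) blast+
qed

text \<open>The form in which consistent orientation is used. In each piece a single direction makes
  both weak inequalities strict: \<open>u + u_minus u\<close> or
  \<open>- u - u_plus u\<close>.\<close>

lemma closed_side_subset_closure:
  assumes "spacelike u"
  shows "closed_side u \<subseteq> closure (crooked_halfspace 0 u)"
proof
  note f = u_frame[OF assms]
  have uu: "lor u u > 0" using assms by (simp add: spacelike_def)
  fix v assume "v \<in> closed_side u"
  then consider "lor v u \<ge> 0" "lor v (u_plus u) \<le> 0" | "lor v u \<le> 0" "lor v (u_minus u) \<ge> 0"
    by (auto simp: closed_side_def)
  then show "v \<in> closure (crooked_halfspace 0 u)"
    unfolding crooked_halfspace_eq_side[OF assms]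
  proof cases
    case 1
    show "v \<in> closure (side u)"
    proof (rule closure_if_ray)
      fix e :: real assume "e > 0"
      then have "e * lor u u > 0" "e * lor (u_minus u) (u_plus u) < 0"
        "e * lor (u_plus u) (u_minus u) < 0"
        using uu f by (auto simp: mult_less_0_iff)
      then show "v + e *\<^sub>R (u + u_minus u) \<in> side u"
        using 1 f by (auto simp: side_def)
    qed
  next
    case 2
    show "v \<in> closure (side u)"
    proof (rule closure_if_ray)
      fix e :: real assume "e > 0"
      then have "e * lor u u > 0" "e * lor (u_minus u) (u_plus u) < 0"
        "e * lor (u_plus u) (u_minus u) < 0"
        using uu f by (auto simp: mult_less_0_iff)
      then show "v + e *\<^sub>R (- u - u_plus u) \<in> side u"
        using 2 f by (auto simp: side_def)
    qed
  qed
qed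

section \<open>Disjointness in Minkowski space\<close>

lemma crooked_plane_subset_closed_side:
  assumes "spacelike u"
  shows "crooked_plane 0 u \<subseteq> closed_side u"
  by (auto simp: closed_side_def crooked_plane_zero_iff[OF assms] zero_le_mult_iff)

lemma closed_side_scale:
  assumes "v \<in> closed_side u" "t \<ge> 0"
  shows "t *\<^sub>R v \<in> closed_side u"
  using assms by (auto simp: closed_side_def mult_nonneg_nonpos)

text \<open>Quadrant vectors are orthogonal to \<open>u\<close> and shift the other two products in
  the favourable direction.\<close>

lemma closed_side_add:
  assumes "spacelike u" "v \<in> closed_side u" "z \<in> stem_quadrant 0 u"
  shows "v + z \<in> closed_side u"
proof -
  note f = u_frame[OF assms(1)]
  have "lor z u = 0" "lor z (u_plus u) \<le> 0" "lor z (u_minus u) \<ge> 0"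
    using assms(3) f by (auto simp: stem_quadrant_zero mult_nonneg_nonpos)
  then show ?thesis using assms(2) by (auto simp: closed_side_def)
qed

text \<open>For such \<open>v\<close>, the products with \<open>u_minus u\<close> and
  \<open>u_plus u\<close> have the same sign, strictly if \<open>lor v u\<close> is nonzero.
  Negation then exchanges the two pieces.\<close>

lemma closed_side_uminus:
  assumes "spacelike u" "v \<in> closed_side u" "lor v v \<le> 0"
  shows "- v \<in> closed_side u"
proof -
  note f = u_frame[OF assms(1)]
  have uu: "lor u u > 0" using assms(1) by (simp add: spacelike_def)
  let ?k = "lor (u_minus u) (u_plus u)"
  have "2 * (lor v (u_minus u) * lor v (u_plus u)) / ?k + (lor v u)\<^sup>2 / lor u u \<le> 0"
    using assms(3) null_frame_lor_self[OF null_frame_u[OF assms(1)] assms(1), of v] by simp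
  moreover have "(lor v u)\<^sup>2 / lor u u \<ge> 0" "lor v u \<noteq> 0 \<Longrightarrow> (lor v u)\<^sup>2 / lor u u > 0"
    using uu by simp_all
  ultimately have "2 * (lor v (u_minus u) * lor v (u_plus u)) / ?k \<le> 0"
    and "lor v u \<noteq> 0 \<Longrightarrow> 2 * (lor v (u_minus u) * lor v (u_plus u)) / ?k < 0"
    by linarith+
  then have "lor v (u_minus u) * lor v (u_plus u) \<ge> 0"
    "lor v u = 0 \<or> lor v (u_minus u) * lor v (u_plus u) > 0"
    using f by (auto simp: divide_le_0_iff divide_less_0_iff)
  then show ?thesis
    using assms(2) by (auto simp: closed_side_def zero_le_mult_iff zero_less_mult_iff)
qed

text \<open>Pairing with \<open>u_plus u\<close> sees only the coefficient of
  \<open>u_minus u\<close>, and conversely; the signs required at \<open>- z\<close> make one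
  coefficient vanish.\<close>

lemma uminus_stem_quadrant_closed_side:
  assumes "spacelike u" "z \<in> stem_quadrant 0 u" "- z \<in> closed_side u"
  shows "(\<exists>a. z = a *\<^sub>R u_minus u) \<or> (\<exists>b. z = b *\<^sub>R u_plus u)"
proof -
  note f = u_frame[OF assms(1)]
  obtain a b where ab: "a \<ge> 0" "b \<ge> 0" "z = a *\<^sub>R u_minus u - b *\<^sub>R u_plus u"
    using assms(2) by (auto simp: stem_quadrant_zero)
  have "a = 0 \<or> b = 0"
    using assms(3) ab f by (auto simp: closed_side_def zero_le_mult_iff mult_le_0_iff)
  moreover have "z = a *\<^sub>R u_minus u \<or> z = (- b) *\<^sub>R u_plus u"
    using calculation ab by auto
  ultimately show ?thesis by blast
qed

text \<open>If \<open>f\<close> vanished at \<open>z\<close>, it would be positive at a nearby point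
  of \<open>S\<close> in direction \<open>d\<close> or \<open>- d\<close>.\<close>

lemma interior_linear_functional:
  fixes f :: "'a::euclidean_space \<Rightarrow> real"
  assumes "linear f" "z \<in> interior S" "\<And>x. x \<in> S \<Longrightarrow> f x \<le> 0" "f d \<noteq> 0"
  shows "f z \<noteq> 0"
proof
  assume z: "f z = 0"
  obtain e where e: "e > 0" "ball z e \<subseteq> S"
    using assms(2) by (auto simp: mem_interior)
  define t where "t = sgn (f d) * (e / (2 * norm d))"
  have "d \<noteq> 0" using assms(1,4) linear_0 by blast
  then have "norm (t *\<^sub>R d) < e" using e assms(4) by (simp add: t_def abs_mult sgn_if)
  then have "z + t *\<^sub>R d \<in> S" using e by (auto simp: subset_eq dist_norm)
  then have "f (z + t *\<^sub>R d) \<le> 0" by (rule assms(3))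
  moreover have "f (z + t *\<^sub>R d) = \<bar>f d\<bar> * (e / (2 * norm d))"
    using assms(1) z by (simp add: linear_add linear_scale t_def sgn_if)
  moreover have "\<bar>f d\<bar> * (e / (2 * norm d)) > 0" using e assms(4) \<open>d \<noteq> 0\<close> by simp
  ultimately show False by linarith
qed

section \<open>Cyclic order of the four null directions\<close>

definition triple :: "real^3 \<Rightarrow> real^3 \<Rightarrow> real^3 \<Rightarrow> real" where
  "triple x y z = det (vector [x, y, z] :: real^3^3)"

lemma triple_simps [simp]:
  "triple x y (v + w) = triple x y v + triple x y w"
  "triple x y (v - w) = triple x y v - triple x y w"
  "triple x y (c *\<^sub>R v) = c * triple x y v"
  "triple x y (- v) = - triple x y v"
  "triple x y x = 0" "triple x y y = 0"
  by (simp_all add: triple_def det_rows algebra_simps)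

lemma triple_rotate: "triple x y z = triple y z x" and triple_swap: "triple x y z = - triple y x z"
  by (simp_all add: triple_def det_rows algebra_simps)

lemma linear_triple: "linear (triple x y)"
  by (intro linearI) simp_all

text \<open>As functionals of \<open>v\<close>, the triple product and \<open>lor v u\<close> both
  vanish on the span of \<open>u_minus u\<close> and \<open>u_plus u\<close>, so they are
  proportional.\<close>

lemma triple_frame:
  assumes "spacelike u"
  shows "triple (u_minus u) (u_plus u) v = lor v u * (triple (u_minus u) (u_plus u) u / lor u u)"
    and "triple (u_minus u) (u_plus u) u > 0"
proof -
  show "triple (u_minus u) (u_plus u) v = lor v u * (triple (u_minus u) (u_plus u) u / lor u u)"
    by (subst null_frame_decompose[OF null_frame_u[OF assms] assms, of v]) simp
  show "triple (u_minus u) (u_plus u) u > 0"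
    using null_frame_u[OF assms] by (simp add: null_frame_def triple_rotate[of u] flip: triple_def)
qed

text \<open>The ends of the stem of \<open>u\<^sub>2\<close> are not in the closed halfspace of \<open>u\<^sub>1\<close>, which determines
  the cyclic order of the four null directions.\<close>

lemma consistently_oriented_triple_neg:
  assumes u: "spacelike u\<^sub>1" "spacelike u\<^sub>2"
    and disj: "closed_side u\<^sub>1 \<inter> closed_side u\<^sub>2 \<subseteq> {0}"
    and x: "x = u_minus u\<^sub>2 \<or> x = u_plus u\<^sub>2"
  shows "triple (u_minus u\<^sub>1) (u_plus u\<^sub>1) x < 0"
proof -
  note f1 = u_frame[OF u(1)] and f2 = u_frame[OF u(2)]
  have fut: "future_null x" "future_null (u_plus u\<^sub>1)"
    using x f1 f2 by (auto simp: future_null_def)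
  have "x \<in> closed_side u\<^sub>2" "x \<noteq> 0"
    using x f2 by (auto simp: closed_side_def)
  then have "x \<notin> closed_side u\<^sub>1" using disj by auto
  \<comment> \<open>Two future null vectors have nonpositive product, so only the sign of
    \<open>lor x u\<^sub>1\<close> can keep \<open>x\<close> out.\<close>
  then have "lor x u\<^sub>1 < 0"
    using future_null_lor_nonpos[OF fut] by (auto simp: closed_side_def)
  then show ?thesis
    using triple_frame(1)[OF u(1), of x] triple_frame(2)[OF u(1)] u(1)
    by (simp add: mult_less_0_iff divide_less_0_iff spacelike_def)
qed

text \<open>If both vectors were on edges, the triple product with the two edge directions would
  vanish at \<open>z\<^sub>1 - z\<^sub>2\<close> and be nonpositive, but not identically zero, on
  the set of differences. This contradicts interiority.\<close>

lemma allowable_pair_not_edges: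
  assumes u: "spacelike u\<^sub>1" "spacelike u\<^sub>2"
    and disj: "closed_side u\<^sub>1 \<inter> closed_side u\<^sub>2 \<subseteq> {0}"
    and allow: "(z\<^sub>1, z\<^sub>2) \<in> allowable_pairs u\<^sub>1 u\<^sub>2"
  shows "\<not> (- z\<^sub>1 \<in> closed_side u\<^sub>1 \<and> - z\<^sub>2 \<in> closed_side u\<^sub>2)"
proof
  assume neg: "- z\<^sub>1 \<in> closed_side u\<^sub>1 \<and> - z\<^sub>2 \<in> closed_side u\<^sub>2"
  define A B C D where ABCD: "A = u_minus u\<^sub>1" "B = u_plus u\<^sub>1" "C = u_minus u\<^sub>2" "D = u_plus u\<^sub>2"
  let ?S = "{a - b | a b. a \<in> stem_quadrant 0 u\<^sub>1 \<and> b \<in> stem_quadrant 0 u\<^sub>2}"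
  have S: "z\<^sub>1 - z\<^sub>2 \<in> interior ?S" and z: "z\<^sub>1 \<in> stem_quadrant 0 u\<^sub>1" "z\<^sub>2 \<in> stem_quadrant 0 u\<^sub>2"
    using allow by (auto simp: allowable_pairs_def)
  have t: "triple A B C < 0" "triple A B D < 0" "triple C D A < 0" "triple C D B < 0"
    using consistently_oriented_triple_neg[OF u disj] disj
      consistently_oriented_triple_neg[OF u(2,1)] by (auto simp: ABCD Int_commute)
  have perm: "triple A C B = - triple A B C" "triple A D B = - triple A B D"
    "triple A C D = triple C D A" "triple A D C = - triple C D A"
    "triple B C A = triple A B C" "triple B D A = triple A B D"
    "triple B C D = triple C D B" "triple B D C = - triple C D B"
    by (simp_all add: triple_def det_rows)
  \<comment> \<open>The set of differences is the cone generated by \<open>A\<close>,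
    \<open>- B\<close>, \<open>- C\<close> and \<open>D\<close>.\<close>
  have supp: "f (z\<^sub>1 - z\<^sub>2) \<noteq> 0"
    if f: "linear f" "f A \<le> 0" "f B \<ge> 0" "f C \<ge> 0" "f D \<le> 0" "f d \<noteq> 0" for f :: "real^3 \<Rightarrow> real" and d
  proof (rule interior_linear_functional[where d = d, OF f(1) S])
    fix x assume "x \<in> ?S"
    then obtain a b c d where "a \<ge> 0" "b \<ge> 0" "c \<ge> 0" "d \<ge> 0"
      and x: "x = (a *\<^sub>R A - b *\<^sub>R B) - (c *\<^sub>R C - d *\<^sub>R D)"
      by (auto simp: stem_quadrant_zero ABCD)
    then have "a * f A \<le> 0" "b * f B \<ge> 0" "c * f C \<ge> 0" "d * f D \<le> 0"
      using f by (simp_all add: mult_nonneg_nonpos)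
    moreover have "f x = a * f A - b * f B - c * f C + d * f D"
      unfolding x using f(1) by (simp add: linear_diff linear_scale)
    ultimately show "f x \<le> 0" by linarith
  qed (fact f(6))
  have "(\<exists>a. z\<^sub>1 = a *\<^sub>R A) \<or> (\<exists>b. z\<^sub>1 = b *\<^sub>R B)" "(\<exists>a. z\<^sub>2 = a *\<^sub>R C) \<or> (\<exists>b. z\<^sub>2 = b *\<^sub>R D)"
    using uminus_stem_quadrant_closed_side[OF u(1) z(1)] uminus_stem_quadrant_closed_side[OF u(2) z(2)]
      neg by (auto simp: ABCD)
  then consider a c where "z\<^sub>1 = a *\<^sub>R A" "z\<^sub>2 = c *\<^sub>R C" | a c where "z\<^sub>1 = a *\<^sub>R A" "z\<^sub>2 = c *\<^sub>R D"
    | a c where "z\<^sub>1 = a *\<^sub>R B" "z\<^sub>2 = c *\<^sub>R C" | a c where "z\<^sub>1 = a *\<^sub>R B" "z\<^sub>2 = c *\<^sub>R D"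
    by blast
  then show False
  proof cases
    case 1
    then show False using supp[OF linear_triple, of A C B] perm t by simp
  next
    case 2
    then show False using supp[OF linear_triple, of A D B] perm t by simp
  next
    case 3
    then show False using supp[OF linear_triple, of B C A] perm t by simp
  next
    case 4
    then show False using supp[OF linear_triple, of B D A] perm t by simp
  qed
qed

lemma translated_closed_sides_disjoint:
  assumes u: "spacelike u\<^sub>1" "spacelike u\<^sub>2"
    and disj: "closed_side u\<^sub>1 \<inter> closed_side u\<^sub>2 \<subseteq> {0}"
    and allow: "(z\<^sub>1, z\<^sub>2) \<in> allowable_pairs u\<^sub>1 u\<^sub>2"
    and v: "v\<^sub>1 \<in> closed_side u\<^sub>1" "v\<^sub>2 \<in> closed_side u\<^sub>2"
  shows "v\<^sub>1 + z\<^sub>1 \<noteq> v\<^sub>2 + z\<^sub>2"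
proof
  assume eq: "v\<^sub>1 + z\<^sub>1 = v\<^sub>2 + z\<^sub>2"
  have "z\<^sub>1 \<in> stem_quadrant 0 u\<^sub>1" "z\<^sub>2 \<in> stem_quadrant 0 u\<^sub>2"
    using allow by (auto simp: allowable_pairs_def)
  then have "v\<^sub>1 + z\<^sub>1 \<in> closed_side u\<^sub>1 \<inter> closed_side u\<^sub>2"
    using closed_side_add[OF u(1) v(1)] closed_side_add[OF u(2) v(2)] eq by (metis IntI)
  then have "v\<^sub>1 + z\<^sub>1 = 0" "v\<^sub>2 + z\<^sub>2 = 0" using disj eq by auto
  then have "v\<^sub>1 = - z\<^sub>1" "v\<^sub>2 = - z\<^sub>2" by (simp_all add: eq_neg_iff_add_eq_0)
  then show False using allowable_pair_not_edges[OF u disj allow] v by simp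
qed

section \<open>Linear models of the maps of the Einstein universe\<close>

definition spat :: "real^5 \<Rightarrow> real^3" where
  "spat X = vector [X$2, X$3, X$4]"

text \<open>Minus the \<open>form32\<close> product with the lift \<open>infty5\<close> of
  \<open>p_infty\<close>: zero on the light cone of \<open>p_infty\<close>, one on every
  \<open>iota5 v\<close>.\<close>

definition lev :: "real^5 \<Rightarrow> real" where
  "lev X = X$1 + X$5"

text \<open>The effect of a translation on \<open>iota5 x\<close>, extended linearly with
  \<open>lev X\<close> in place of the constant one.\<close>

definition trans5 :: "real^3 \<Rightarrow> real^5 \<Rightarrow> real^5" where
  "trans5 v X = embed5 (X$1 - lor (spat X) v - lev X * lor v v / 2) (spat X + lev X *\<^sub>R v)
     (X$5 + lor (spat X) v + lev X * lor v v / 2)"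

definition refl5 :: "real^5 \<Rightarrow> real^5" where
  "refl5 X = vector [- X$1, X$2, X$3, X$4, X$5]"

lemma embed5_nth [simp]:
  "embed5 a v b $ 1 = a" "embed5 a v b $ 2 = v$1" "embed5 a v b $ 3 = v$2" "embed5 a v b $ 4 = v$3"
  "embed5 a v b $ 5 = b"
  by (simp_all add: embed5_def vector_5)

lemma spat_nth [simp]: "spat X $ 1 = X$2" "spat X $ 2 = X$3" "spat X $ 3 = X$4"
  by (simp_all add: spat_def vector_3)

lemma refl5_nth [simp]:
  "refl5 X $ 1 = - X$1" "refl5 X $ 2 = X$2" "refl5 X $ 3 = X$3" "refl5 X $ 4 = X$4" "refl5 X $ 5 = X$5"
  by (simp_all add: refl5_def vector_5)

lemma vec_eq_5: "X = Y \<longleftrightarrow> X$1 = Y$1 \<and> spat X = spat Y \<and> X$5 = Y$5" for X Y :: "real^5"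
  by (auto simp: vec_eq_iff forall_5 forall_3)

lemma spat_simps [simp]:
  "spat (embed5 a v b) = v" "spat (X + Y) = spat X + spat Y" "spat (c *\<^sub>R X) = c *\<^sub>R spat X"
  "spat (refl5 X) = spat X" "spat (trans5 v X) = spat X + lev X *\<^sub>R v" "spat 0 = 0"
  "spat (X - Y) = spat X - spat Y"
  by (simp_all add: vec_eq_iff forall_3 trans5_def)

lemma lev_simps [simp]:
  "lev (embed5 a v b) = a + b" "lev (c *\<^sub>R X) = c * lev X" "lev (trans5 v X) = lev X"
  "lev (refl5 X) = X$5 - X$1"
  by (simp_all add: lev_def trans5_def algebra_simps)

lemma form32_eq: "form32 X Y = X$1 * Y$1 + lor (spat X) (spat Y) - X$5 * Y$5"
  by (simp add: form32_def lor_def)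

text \<open>Factorization of \<open>X$5\<close> squared minus \<open>X$1\<close> squared;
  \<open>refl5\<close> exchanges the two factors.\<close>

lemma null_cone32_iff:
  "X \<in> null_cone32 \<longleftrightarrow> X \<noteq> 0 \<and> lor (spat X) (spat X) = lev X * lev (refl5 X)"
  by (auto simp: null_cone32_def form32_eq lev_def algebra_simps)

lemma linear_trans5: "linear (trans5 v)"
  by (intro linearI) (simp_all add: vec_eq_5 trans5_def lev_def algebra_simps add_divide_distrib)

lemma linear_refl5: "linear refl5"
  by (intro linearI) (simp_all add: vec_eq_5)

lemma form32_trans5: "form32 (trans5 v X) (trans5 v Y) = form32 X Y"
  by (simp add: form32_eq trans5_def lev_def lor_commute[of v "spat X"] lor_commute[of v "spat Y"] algebra_simps)
    (simp add: field_simps)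

lemma form32_refl5: "form32 (refl5 X) (refl5 Y) = form32 X Y"
  by (simp add: form32_eq)

lemma trans5_add: "trans5 v (trans5 w X) = trans5 (w + v) X"
  by (simp add: vec_eq_5) (simp add: trans5_def lev_def lor_commute[of v w] algebra_simps add_divide_distrib)

lemma trans5_zero: "trans5 0 X = X"
  by (simp add: vec_eq_5 trans5_def)

lemma refl5_refl5: "refl5 (refl5 X) = X"
  by (simp add: vec_eq_5)

lemma isometry_null_cone32:
  assumes "linear f" "\<And>X. g (f X) = X" "linear g" "\<And>X Y. form32 (f X) (f Y) = form32 X Y"
  shows "f X \<in> null_cone32 \<longleftrightarrow> X \<in> null_cone32"
  using assms(4)[of X X] assms(2)[of X] linear_0[OF assms(1)] linear_0[OF assms(3)]
  by (auto simp: null_cone32_def)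

lemma trans5_null_cone32: "trans5 v X \<in> null_cone32 \<longleftrightarrow> X \<in> null_cone32"
  by (rule isometry_null_cone32[where g = "trans5 (- v)"])
    (simp_all add: linear_trans5 form32_trans5 trans5_add trans5_zero)

lemma refl5_null_cone32: "refl5 X \<in> null_cone32 \<longleftrightarrow> X \<in> null_cone32"
  by (rule isometry_null_cone32[where g = refl5]) (simp_all add: linear_refl5 form32_refl5 refl5_refl5)

definition iota5 :: "real^3 \<Rightarrow> real^5" where
  "iota5 v = embed5 ((1 - lor v v) / 2) v ((1 + lor v v) / 2)"

definition infty5 :: "real^5" where
  "infty5 = embed5 (-1) 0 1"

lemma iota5_null: "iota5 v \<in> null_cone32"
  by (simp add: null_cone32_iff iota5_def vec_eq_5 field_simps)

lemma infty5_null: "infty5 \<in> null_cone32"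
  by (simp add: null_cone32_iff infty5_def vec_eq_5)

lemma ein_iota_eq: "ein_iota v = ein_proj (iota5 v)"
  by (simp add: ein_iota_def iota5_def)

lemma p_infty_eq: "p_infty = ein_proj infty5"
  by (simp add: p_infty_def infty5_def)

lemma trans5_iota5: "trans5 v (iota5 x) = iota5 (x + v)"
  by (simp add: vec_eq_5 iota5_def) (simp add: trans5_def lor_commute[of v x] field_simps)

lemma trans5_infty5: "trans5 v infty5 = infty5"
  by (simp add: vec_eq_5 infty5_def trans5_def)

lemma scaleR_null_cone32: "t \<noteq> 0 \<Longrightarrow> X \<in> null_cone32 \<Longrightarrow> t *\<^sub>R X \<in> null_cone32"
  by (auto simp: null_cone32_iff right_diff_distrib mult.left_commute)

lemma ein_proj_eq_iff:
  assumes "X \<in> null_cone32" "Y \<in> null_cone32"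
  shows "ein_proj X = ein_proj Y \<longleftrightarrow> (\<exists>t. t \<noteq> 0 \<and> Y = t *\<^sub>R X)"
proof -
  have refl: "ein_rel Z Z" if "Z \<in> null_cone32" for Z
    using that by (auto simp: ein_rel_def intro: exI[of _ 1])
  show ?thesis
    using Quotient3_rel[OF Quotient3_ein3, of X Y] refl assms by (auto simp: ein_proj_def ein_rel_def)
qed

lemma ein_proj_scaleR: "X \<in> null_cone32 \<Longrightarrow> t \<noteq> 0 \<Longrightarrow> ein_proj (t *\<^sub>R X) = ein_proj X"
  using ein_proj_eq_iff[of X "t *\<^sub>R X"] scaleR_null_cone32 by auto

lemma ein_proj_cases:
  obtains X where "X \<in> null_cone32" "q = ein_proj X"
proof
  have "ein_rel (rep_ein3 q) (rep_ein3 q)" by (rule Quotient3_rep_reflp[OF Quotient3_ein3])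
  then show "rep_ein3 q \<in> null_cone32" by (simp add: ein_rel_def)
  show "q = ein_proj (rep_ein3 q)"
    by (simp add: ein_proj_def Quotient3_abs_rep[OF Quotient3_ein3])
qed

lemma ein_rho_proj:
  assumes "X \<in> null_cone32"
  shows "ein_rho (ein_proj X) = ein_proj (refl5 X)"
proof -
  have "ein_rel X X" using assms by (auto simp: ein_rel_def intro: exI[of _ 1])
  then show ?thesis unfolding ein_proj_def refl5_def by (rule ein_rho.abs_eq)
qed

lemma matrix_O32:
  assumes "linear f" "\<And>X Y. form32 (f X) (f Y) = form32 X Y"
  shows "matrix f \<in> O32"
  using assms by (simp add: O32_def matrix_works)

text \<open>Linear relations among the eigenvectors force all eigenvalues to agree, and these
  eigenvectors span the space.\<close>

lemma eigenlines_iota5_scalar: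
  fixes h :: "real^5 \<Rightarrow> real^5"
  assumes h: "linear h" and ev: "\<And>x. \<exists>c. h (iota5 x) = c *\<^sub>R iota5 x"
    and inf: "\<exists>c. h infty5 = c *\<^sub>R infty5"
  shows "\<exists>c. \<forall>X. h X = c *\<^sub>R X"
proof -
  obtain l where l: "\<And>x. h (iota5 x) = l x *\<^sub>R iota5 x" using ev by metis
  obtain m where m: "h infty5 = m *\<^sub>R infty5" using inf by blast
  have iota: "iota5 x = iota5 0 + embed5 0 x 0 + (lor x x / 2) *\<^sub>R infty5" for x
    by (simp add: vec_eq_5 iota5_def infty5_def field_simps)
  have rel: "l x = l 0 \<and> lor x x * m = lor x x * l 0" for x
  proof -
    \<comment> \<open>In this relation, \<open>spat\<close> gives \<open>l x = l (- x)\<close> for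
      nonzero \<open>x\<close>, \<open>lev\<close> gives their sum, and the last coordinate brings
      in \<open>m\<close>.\<close>
    have "iota5 x + iota5 (- x) = 2 *\<^sub>R iota5 0 + lor x x *\<^sub>R infty5"
      by (simp add: vec_eq_5 iota5_def infty5_def field_simps)
    from arg_cong[OF this, of h] have eq: "l x *\<^sub>R iota5 x + l (- x) *\<^sub>R iota5 (- x)
        = (2 * l 0) *\<^sub>R iota5 0 + (lor x x * m) *\<^sub>R infty5"
      by (simp add: l m linear_add[OF h] linear_scale[OF h])
    from arg_cong[OF eq, of spat] have s: "(l x - l (- x)) *\<^sub>R x = 0"
      by (simp add: iota5_def infty5_def algebra_simps)
    from arg_cong[OF eq, of lev] have "l x + l (- x) = 2 * l 0"
      by (simp add: iota5_def infty5_def lev_def field_simps)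
    moreover from arg_cong[OF eq, of "\<lambda>X. X$5"]
    have "l x * (1 + lor x x) + l (- x) * (1 + lor x x) = 2 * l 0 + 2 * (lor x x * m)"
      by (simp add: iota5_def infty5_def field_simps)
    ultimately show ?thesis
      using s by (cases "x = 0") (auto simp: algebra_simps)
  qed
  \<comment> \<open>Any \<open>x\<close> with \<open>lor x x\<close> nonzero will do.\<close>
  have "m = l 0"
    using rel[of "vector [1, 0, 0]"] by (simp add: lor_def vector_3)
  then have "h (embed5 0 x 0) = l 0 *\<^sub>R embed5 0 x 0" for x
  proof -
    have e: "embed5 0 x 0 = iota5 x - iota5 0 - (lor x x / 2) *\<^sub>R infty5"
      by (subst iota[of x]) simp
    show ?thesis unfolding e using h l m rel[of x] \<open>m = l 0\<close>
      by (simp add: linear_diff linear_scale scaleR_diff_right mult.commute)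
  qed
  then have "h (a *\<^sub>R iota5 0 + embed5 0 x 0 + b *\<^sub>R infty5)
      = l 0 *\<^sub>R (a *\<^sub>R iota5 0 + embed5 0 x 0 + b *\<^sub>R infty5)" for a b x
    by (simp add: linear_add[OF h] linear_scale[OF h] l m \<open>m = l 0\<close> scaleR_add_right mult.commute)
  moreover have "lev X *\<^sub>R iota5 0 + embed5 0 (spat X) 0 + (lev (refl5 X) / 2) *\<^sub>R infty5 = X" for X
    by (simp add: vec_eq_5 iota5_def infty5_def lev_def field_simps)
  ultimately have "h X = l 0 *\<^sub>R X" for X by metis
  then show ?thesis by blast
qed

section \<open>Translations and the uniqueness of \<open>ein_tau\<close>\<close>

lift_definition ein_trans :: "real^3 \<Rightarrow> ein3 \<Rightarrow> ein3" is trans5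
  by (auto simp: ein_rel_def trans5_null_cone32 linear_scale[OF linear_trans5])

lemma ein_trans_proj:
  assumes "X \<in> null_cone32"
  shows "ein_trans v (ein_proj X) = ein_proj (trans5 v X)"
proof -
  have "ein_rel X X" using assms by (auto simp: ein_rel_def intro: exI[of _ 1])
  then show ?thesis unfolding ein_proj_def by (rule ein_trans.abs_eq)
qed

lemma sum_5: "sum f (UNIV :: 5 set) = f 1 + f 2 + f 3 + f 4 + (f 5 :: 'a::ab_group_add)"
proof -
  have UNIV_5: "(UNIV :: 5 set) = {1, 2, 3, 4, 5}" using exhaust_5 by auto
  show ?thesis unfolding UNIV_5 by (simp add: ac_simps)
qed

text \<open>With \<open>J\<close> the Gram matrix of \<open>form32\<close>, take determinants in
  \<open>transpose A ** J ** A = J\<close>.\<close>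

lemma det_O32:
  assumes "A \<in> O32"
  shows "det A * det A = 1"
proof -
  define J :: "real^5^5" where "J = (\<chi> i j. if i = j then (if i = 4 \<or> i = 5 then -1 else 1) else 0)"
  have J: "form32 x y = inner x (J *v y)" for x y
  proof -
    have "(J *v y) $ i = (if i = 4 \<or> i = 5 then - (y $ i) else y $ i)" for i
      by (simp add: matrix_vector_mult_def J_def if_distrib[of "\<lambda>c. c * _"] cong: if_cong)
    then show ?thesis by (simp add: form32_def inner_vec_def sum_5)
  qed
  have "inner x ((transpose A ** J ** A) *v y) = inner x (J *v y)" for x y
  proof -
    have "inner x ((transpose A ** J ** A) *v y) = inner (A *v x) (J *v (A *v y))"
      by (simp only: matrix_vector_mul_assoc[symmetric] dot_lmul_matrix[symmetric, of x "transpose A"]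
          vector_transpose_matrix)
    then show ?thesis using assms by (simp add: O32_def J)
  qed
  then have "(transpose A ** J ** A) *v y = J *v y" for y
    using vector_eq_ldot by blast
  then have "transpose A ** J ** A = J" unfolding matrix_eq by blast
  from arg_cong[OF this, of det] have "det A * det J * det A = det J" by (simp add: det_mul)
  moreover have "det J \<noteq> 0"
    by (subst det_diagonal) (auto simp: J_def)
  ultimately show ?thesis by (simp add: algebra_simps)
qed

lemma O32_null_cone32:
  assumes "A \<in> O32" "X \<in> null_cone32"
  shows "A *v X \<in> null_cone32"
proof -
  have "det A \<noteq> 0" using det_O32[OF assms(1)] by auto
  then have "A *v X \<noteq> 0"
    using assms(2) invertible_det_nz[of A] inj_matrix_vector_mult[of A]
    by (auto simp: null_cone32_def inj_def)
  then show ?thesis using assms by (simp add: O32_def null_cone32_def)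
qed

text \<open>For uniqueness, undoing the translation leaves a linear map that preserves the lines of
  \<open>infty5\<close> and of every \<open>iota5 x\<close>. It is a scalar, invisible after
  projection.\<close>

lemma ein_tau_eq_trans: "ein_tau v = ein_trans v"
  unfolding ein_tau_def
proof (rule the_equality, intro conjI allI bexI)
  have M: "matrix (trans5 v) *v X = trans5 v X" for X by (simp add: matrix_works linear_trans5)
  show "matrix (trans5 v) \<in> O32" by (intro matrix_O32 linear_trans5 form32_trans5)
  show "induces (matrix (trans5 v)) (ein_trans v)" by (simp add: induces_def M ein_trans_proj)
  show "ein_trans v p_infty = p_infty"
    by (simp add: p_infty_eq ein_trans_proj infty5_null trans5_infty5)
  show "ein_trans v (ein_iota x) = ein_iota (x + v)" for x
    by (simp add: ein_iota_eq ein_trans_proj iota5_null trans5_iota5)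
next
  fix g assume "(\<exists>A\<in>O32. induces A g) \<and> g p_infty = p_infty \<and> (\<forall>x. g (ein_iota x) = ein_iota (x + v))"
  then obtain A where A: "A \<in> O32" "induces A g" and inf: "g p_infty = p_infty"
    and g: "\<And>x. g (ein_iota x) = ein_iota (x + v)" by blast
  define h where "h X = trans5 (- v) (A *v X)" for X
  have h: "linear h" unfolding h_def
    using linear_compose[OF matrix_vector_mul_linear linear_trans5] by (simp add: o_def)
  have scal: "\<exists>c. h X = c *\<^sub>R Y" if "X \<in> null_cone32" "Y \<in> null_cone32" "g (ein_proj X) = ein_proj (trans5 v Y)" for X Y
  proof -
    have "ein_proj (trans5 v Y) = ein_proj (A *v X)" using A(2) that by (simp add: induces_def)
    with that O32_null_cone32[OF A(1)] obtain t where "A *v X = t *\<^sub>R trans5 v Y"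
      by (auto simp: ein_proj_eq_iff trans5_null_cone32)
    then show ?thesis by (auto simp: h_def linear_scale[OF linear_trans5] trans5_add trans5_zero)
  qed
  have "\<exists>c. \<forall>X. h X = c *\<^sub>R X"
    using scal[OF infty5_null infty5_null] scal[OF iota5_null iota5_null] inf g h
    by (intro eigenlines_iota5_scalar) (auto simp: trans5_iota5 trans5_infty5 p_infty_eq ein_iota_eq)
  then obtain c where c: "\<And>X. h X = c *\<^sub>R X" by blast
  have AX: "A *v X = c *\<^sub>R trans5 v X" for X
  proof -
    have "A *v X = trans5 v (h X)" by (simp add: h_def trans5_add trans5_zero)
    then show ?thesis by (simp add: c linear_scale[OF linear_trans5])
  qed
  have "c \<noteq> 0" using AX[of infty5] O32_null_cone32[OF A(1) infty5_null] by (auto simp: null_cone32_def)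
  show "g = ein_trans v"
  proof
    fix q obtain X where X: "X \<in> null_cone32" "q = ein_proj X" by (rule ein_proj_cases)
    then show "g q = ein_trans v q"
      using A(2) \<open>c \<noteq> 0\<close> by (simp add: induces_def AX ein_trans_proj ein_proj_scaleR trans5_null_cone32)
  qed
qed

section \<open>Crooked surfaces\<close>

definition photon5 :: "real^3 \<Rightarrow> (real^5) set" where
  "photon5 v = {a *\<^sub>R infty5 + b *\<^sub>R embed5 0 v 0 | a b. True}"

lemma photon5_eq_span: "photon5 v = span {infty5, embed5 0 v 0}"
proof (rule set_eqI)
  fix X
  have "X \<in> span {infty5, embed5 0 v 0}
      \<longleftrightarrow> (\<exists>a b. X - a *\<^sub>R infty5 = b *\<^sub>R embed5 0 v 0)"
    by (simp add: span_insert[of infty5] span_singleton image_iff)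
  then show "X \<in> photon5 v \<longleftrightarrow> X \<in> span {infty5, embed5 0 v 0}"
    by (simp add: photon5_def diff_eq_eq add.commute)
qed

text \<open>An isotropic plane whose photon contains both points contains both of their lifts,
  because it is closed under scaling; by dimension it is their span.\<close>

lemma photon_through_infty:
  assumes "future_null v"
  shows "photon_through p_infty (ein_proj (embed5 0 v 0)) = ein_proj ` (photon5 v - {0})"
proof -
  let ?V = "embed5 0 v 0"
  have v: "lor v v = 0" "v \<noteq> 0" using assms by (auto simp: future_null_def)
  have V: "?V \<in> null_cone32" using v by (auto simp: null_cone32_iff vec_eq_5)
  have nz: "infty5 \<noteq> 0" "?V \<noteq> 0" using V infty5_null by (auto simp: null_cone32_def)
  have iso: "form32 x y = 0" if "x \<in> photon5 v" "y \<in> photon5 v" for x y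
    using that v by (auto simp: photon5_def form32_eq infty5_def)
  have "infty5 \<notin> span {?V}"
    by (auto simp: span_singleton vec_eq_5 infty5_def)
  then have "independent {infty5, ?V}" "infty5 \<noteq> ?V"
    using nz by (auto simp: independent_insert span_base)
  then have dim: "dim (photon5 v) = 2"
    unfolding photon5_eq_span by (simp add: dim_eq_card_independent)
  have sub: "subspace (photon5 v)" unfolding photon5_eq_span by simp
  have mem: "infty5 \<in> photon5 v" "?V \<in> photon5 v"
    unfolding photon5_eq_span by (auto intro: span_base)
  show ?thesis
    unfolding photon_through_def
  proof (rule the_equality, intro conjI)
    show "photon (ein_proj ` (photon5 v - {0}))"
      unfolding photon_def using sub dim iso by blast
    show "p_infty \<in> ein_proj ` (photon5 v - {0})" "ein_proj ?V \<in> ein_proj ` (photon5 v - {0})"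
      using mem nz by (auto simp: p_infty_eq)
  next
    fix F assume "photon F \<and> p_infty \<in> F \<and> ein_proj ?V \<in> F"
    then obtain W where W: "subspace W" "dim W = 2" "\<forall>x\<in>W. \<forall>y\<in>W. form32 x y = 0"
      and F: "F = ein_proj ` (W - {0})" and mem: "p_infty \<in> F" "ein_proj ?V \<in> F"
      by (auto simp: photon_def)
    have "Y \<in> W" if Y: "Y \<in> null_cone32" "ein_proj Y \<in> F" for Y
    proof -
      obtain X where X: "X \<in> W" "X \<noteq> 0" "ein_proj X = ein_proj Y" using Y(2) unfolding F by fastforce
      then have "X \<in> null_cone32" using W(3) by (simp add: null_cone32_def)
      then obtain t where "Y = t *\<^sub>R X" using X(3) Y(1) by (auto simp: ein_proj_eq_iff)
      then show ?thesis using W(1) X(1) by (simp add: subspace_scale)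
    qed
    then have "{infty5, ?V} \<subseteq> W" using mem V infty5_null by (auto simp: p_infty_eq)
    then have "photon5 v \<subseteq> W" unfolding photon5_eq_span using W(1) by (rule span_minimal)
    then have "photon5 v = W"
      using sub W dim by (intro subspace_dim_equal) auto
    then show "F = ein_proj ` (photon5 v - {0})" by (simp add: F)
  qed
qed

lemma photon5_null:
  assumes "future_null v" "X \<in> photon5 v - {0}"
  shows "X \<in> null_cone32"
  using assms by (auto simp: photon5_def null_cone32_def form32_eq infty5_def future_null_def)

text \<open>On this plane \<open>lev\<close> vanishes, so a translation only adds a multiple of
  \<open>infty5\<close>.\<close>

lemma trans5_photon5:
  assumes "X \<in> photon5 v - {0}"
  shows "trans5 z X \<in> photon5 v - {0}"
proof -
  have nz: "trans5 z X \<noteq> 0"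
    using assms trans5_add[of "- z" z X] linear_0[OF linear_trans5] by (auto simp: trans5_zero)
  obtain a b where "X = a *\<^sub>R infty5 + b *\<^sub>R embed5 0 v 0" using assms by (auto simp: photon5_def)
  then have "trans5 z X = (a + b * lor v z) *\<^sub>R infty5 + b *\<^sub>R embed5 0 v 0"
    by (simp add: vec_eq_5 infty5_def) (simp add: trans5_def lev_def)
  then show ?thesis using nz by (auto simp: photon5_def)
qed

lemma ein_trans_add: "ein_trans v (ein_trans w q) = ein_trans (w + v) q"
  by (cases q rule: ein_proj_cases) (simp add: ein_trans_proj trans5_null_cone32 trans5_add)

lemma ein_trans_zero: "ein_trans 0 q = q"
  by (cases q rule: ein_proj_cases) (simp add: ein_trans_proj trans5_zero)

lemma ein_trans_photon:
  assumes "future_null v"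
  shows "ein_trans z ` ein_proj ` (photon5 v - {0}) = ein_proj ` (photon5 v - {0})"
proof -
  let ?P = "ein_proj ` (photon5 v - {0})"
  have *: "ein_trans w q \<in> ?P" if "q \<in> ?P" for w q
    using that photon5_null[OF assms] trans5_photon5 by (auto simp: ein_trans_proj)
  have "q \<in> ein_trans z ` ?P" if "q \<in> ?P" for q
    using *[OF that, of "- z"] ein_trans_add[of z "- z" q] ein_trans_zero[of q]
    by (metis image_eqI neg_equal_iff_equal add.left_inverse)
  then show ?thesis using * by blast
qed

lemma u_frame_future_null:
  assumes "spacelike u"
  shows "future_null (u_plus u)" "future_null (u_minus u)"
  using null_frame_u[OF assms] by (auto simp: null_frame_def)

lemma crooked_plane_conf_eq:
  assumes "spacelike u"
  shows "crooked_plane_conf z u = ein_proj ` (iota5 ` crooked_plane z u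
    \<union> (photon5 (u_plus u) - {0}) \<union> (photon5 (u_minus u) - {0}))"
  using u_frame_future_null[OF assms]
  by (simp add: crooked_plane_conf_def photon_through_infty image_Un image_image ein_iota_eq)

lemma crooked_plane_conf_translate:
  assumes "spacelike u"
  shows "crooked_plane_conf z u = ein_trans z ` crooked_plane_conf 0 u"
proof -
  have "crooked_plane z u = (+) z ` crooked_plane 0 u"
    by (simp add: crooked_plane_def)
  then have "ein_proj ` iota5 ` crooked_plane z u = ein_trans z ` ein_proj ` iota5 ` crooked_plane 0 u"
    by (simp add: image_image ein_trans_proj iota5_null trans5_iota5 add.commute)
  then show ?thesis
    using u_frame_future_null[OF assms]
    by (simp add: crooked_plane_conf_eq[OF assms] image_Un ein_trans_photon)
qed

text \<open>A null vector \<open>X\<close> with \<open>lev X \<noteq> 0\<close> represents the image under \<open>\<iota>\<close> of \<open>spat X / lev X\<close>,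
  a positive multiple of \<open>lev X *\<^sub>R spat X\<close>; the other null vectors represent the light cone of
  \<open>p\<^sub>\<infinity>\<close>, where the sign of \<open>spat X\<close> is irrelevant by \<open>closed_side_uminus\<close>.\<close>

definition side5 :: "real^3 \<Rightarrow> (real^5) set" where
  "side5 u = {X \<in> null_cone32. (if lev X = 0 then spat X else lev X *\<^sub>R spat X) \<in> closed_side u}"

lemma closed_side_scale_causal:
  assumes "spacelike u" "v \<in> closed_side u" "lor v v \<le> 0"
  shows "t *\<^sub>R v \<in> closed_side u"
  using closed_side_scale[OF assms(2), of t] closed_side_scale[OF closed_side_uminus[OF assms], of "- t"]
  by (cases "t \<ge> 0") auto

text \<open>Rescaling multiplies \<open>lev X *\<^sub>R spat X\<close> by a positive square. If
  \<open>lev X = 0\<close>, then \<open>spat X\<close> is null and either sign is allowed.\<close>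

lemma side5_scale:
  assumes "spacelike u" "X \<in> side5 u" "t \<noteq> 0"
  shows "t *\<^sub>R X \<in> side5 u"
proof (cases "lev X = 0")
  case True
  then show ?thesis
    using assms closed_side_scale_causal[OF assms(1), of "spat X" t]
    by (simp add: side5_def scaleR_null_cone32) (simp add: null_cone32_iff)
next
  case False
  then show ?thesis
    using assms False closed_side_scale[of "lev X *\<^sub>R spat X" u "t * t"]
    by (simp add: side5_def scaleR_null_cone32 ac_simps)
qed

lemma trans5_side5:
  assumes "spacelike u" "X \<in> side5 u" "z \<in> stem_quadrant 0 u"
  shows "trans5 z X \<in> side5 u"
proof (cases "lev X = 0")
  case True
  then show ?thesis using assms(2) by (simp add: side5_def trans5_null_cone32)
next
  case False
  obtain a b where "a \<ge> 0" "b \<ge> 0" and z: "z = a *\<^sub>R u_minus u - b *\<^sub>R u_plus u"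
    using assms(3) by (auto simp: stem_quadrant_zero)
  then have "(lev X * lev X) *\<^sub>R z = (lev X * lev X * a) *\<^sub>R u_minus u - (lev X * lev X * b) *\<^sub>R u_plus u"
    "0 \<le> lev X * lev X * a" "0 \<le> lev X * lev X * b"
    by (simp_all add: scaleR_diff_right)
  then have "(lev X * lev X) *\<^sub>R z \<in> stem_quadrant 0 u"
    unfolding stem_quadrant_zero by blast
  then have "lev X *\<^sub>R spat X + (lev X * lev X) *\<^sub>R z \<in> closed_side u"
    using assms(2) False by (intro closed_side_add[OF assms(1)]) (auto simp: side5_def)
  then show ?thesis
    using assms(2) False by (simp add: side5_def trans5_null_cone32 scaleR_add_right)
qed

text \<open>Reflection keeps \<open>x\<close> and exchanges \<open>s\<close> and \<open>r\<close>,
  where \<open>lor x x = s * r\<close>. If \<open>s * r > 0\<close>, then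
  \<open>r *\<^sub>R x\<close> is a positive multiple of \<open>s *\<^sub>R x\<close>; otherwise
  \<open>x\<close> is causal or zero, and all its multiples stay in the closed halfspace.\<close>

lemma refl5_side5:
  assumes "spacelike u" "X \<in> side5 u"
  shows "refl5 X \<in> side5 u"
proof -
  define s r x where "s = lev X" "r = lev (refl5 X)" "x = spat X"
  have null: "X \<in> null_cone32" and x: "lor x x = s * r"
    and mem: "(if s = 0 then x else s *\<^sub>R x) \<in> closed_side u"
    using assms(2) unfolding side5_def s_r_x_def by (auto simp: null_cone32_iff)
  have inv: "t *\<^sub>R x \<in> closed_side u" if "s \<noteq> 0" "s * r \<le> 0" for t
  proof -
    have "lor (s *\<^sub>R x) (s *\<^sub>R x) = s\<^sup>2 * (s * r)" by (simp add: x power2_eq_square)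
    also have "\<dots> \<le> 0" using that(2) by (simp add: mult_nonneg_nonpos)
    finally show ?thesis
      using closed_side_scale_causal[OF assms(1), of "s *\<^sub>R x" "t / s"] mem that(1) by simp
  qed
  have "(if r = 0 then x else r *\<^sub>R x) \<in> closed_side u"
  proof (cases "s = 0")
    case True
    then show ?thesis using closed_side_scale_causal[OF assms(1), of x r] mem x by simp
  next
    case s: False
    consider "s * r > 0" | "r = 0" | "s * r < 0"
      using s by (metis linorder_neqE_linordered_idom mult_eq_0_iff)
    then show ?thesis
    proof cases
      case 1
      then have "r *\<^sub>R x = (r / s) *\<^sub>R (s *\<^sub>R x)" "r / s \<ge> 0" "r \<noteq> 0"
        by (auto simp: zero_less_mult_iff zero_le_divide_iff)
      then show ?thesis using closed_side_scale[of "s *\<^sub>R x" u "r / s"] mem s by simp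
    next
      case 2
      then show ?thesis using inv[of 1] s by simp
    next
      case 3
      then show ?thesis using inv[of r] s by auto
    qed
  qed
  then show ?thesis using null unfolding side5_def s_r_x_def
    by (simp add: refl5_null_cone32 del: lev_simps split: if_splits)
qed

lemma crooked_plane_conf_side5:
  assumes "spacelike u" "q \<in> crooked_plane_conf 0 u"
  shows "\<exists>X\<in>side5 u. q = ein_proj X"
proof -
  have "iota5 ` crooked_plane 0 u \<subseteq> side5 u"
    using crooked_plane_subset_closed_side[OF assms(1)] iota5_null
    by (auto simp: side5_def) (auto simp: iota5_def field_simps)
  moreover have "photon5 v - {0} \<subseteq> side5 u" if v: "v = u_plus u \<or> v = u_minus u" for v
  proof
    fix X assume X: "X \<in> photon5 v - {0}"
    have "future_null v" using v u_frame_future_null[OF assms(1)] by auto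
    with X have "X \<in> null_cone32" by (rule photon5_null[rotated])
    moreover obtain a b where "X = a *\<^sub>R infty5 + b *\<^sub>R embed5 0 v 0"
      using X by (auto simp: photon5_def)
    then have "lev X = 0" "spat X = b *\<^sub>R v" by (simp_all add: infty5_def lev_def)
    moreover have "b *\<^sub>R v \<in> closed_side u"
      using v u_frame[OF assms(1)] by (auto simp: closed_side_def)
    ultimately show "X \<in> side5 u" by (simp add: side5_def)
  qed
  ultimately show ?thesis
    using assms(2) unfolding crooked_plane_conf_eq[OF assms(1)] by blast
qed

text \<open>If \<open>lev X\<^sub>1\<close> is nonzero, dividing by it gives points of the two
  closed halfspaces with equal translates. If it is zero, translations do not change
  \<open>spat\<close>, which then lies in both closed halfspaces.\<close>

lemma side5_translates_meet_at_infinity: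
  assumes u: "spacelike u\<^sub>1" "spacelike u\<^sub>2"
    and disj: "closed_side u\<^sub>1 \<inter> closed_side u\<^sub>2 \<subseteq> {0}"
    and allow: "(z\<^sub>1, z\<^sub>2) \<in> allowable_pairs u\<^sub>1 u\<^sub>2"
    and X: "X\<^sub>1 \<in> side5 u\<^sub>1" "X\<^sub>2 \<in> side5 u\<^sub>2"
    and eq: "trans5 z\<^sub>1 X\<^sub>1 = trans5 z\<^sub>2 X\<^sub>2"
  shows "lev X\<^sub>1 = 0" "spat X\<^sub>1 = 0" "X\<^sub>2 = X\<^sub>1"
proof -
  have lev: "lev X\<^sub>2 = lev X\<^sub>1" using arg_cong[OF eq, of lev] by simp
  have spat: "spat X\<^sub>1 + lev X\<^sub>1 *\<^sub>R z\<^sub>1 = spat X\<^sub>2 + lev X\<^sub>1 *\<^sub>R z\<^sub>2"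
    using arg_cong[OF eq, of spat] lev by simp
  show 0: "lev X\<^sub>1 = 0"
  proof (rule ccontr)
    let ?s = "lev X\<^sub>1"
    assume s: "?s \<noteq> 0"
    \<comment> \<open>The inverse of \<open>?s\<close> is \<open>?s\<close> times a positive number,
      so the sign of \<open>?s\<close> is harmless.\<close>
    have pt: "inverse ?s *\<^sub>R spat X \<in> closed_side u" if "X \<in> side5 u" "lev X = ?s" for X u
    proof -
      have "inverse (?s * ?s) *\<^sub>R (?s *\<^sub>R spat X) \<in> closed_side u"
        using that s by (intro closed_side_scale[where v = "?s *\<^sub>R spat X"]) (auto simp: side5_def)
      then show ?thesis using s by (simp add: inverse_eq_divide)
    qed
    have "inverse ?s *\<^sub>R (spat X\<^sub>1 + ?s *\<^sub>R z\<^sub>1) = inverse ?s *\<^sub>R (spat X\<^sub>2 + ?s *\<^sub>R z\<^sub>2)"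
      using spat by simp
    then have "inverse ?s *\<^sub>R spat X\<^sub>1 + z\<^sub>1 = inverse ?s *\<^sub>R spat X\<^sub>2 + z\<^sub>2"
      using s by (simp add: scaleR_add_right)
    then show False
      using translated_closed_sides_disjoint[OF u disj allow pt[OF X(1)] pt[OF X(2) lev]] by simp
  qed
  then show 1: "spat X\<^sub>1 = 0" using spat lev X disj by (auto simp: side5_def)
  show "X\<^sub>2 = X\<^sub>1" using eq 0 1 lev spat by (simp add: vec_eq_5 trans5_def)
qed

section \<open>Crooked surfaces and their intersection\<close>

lemma crooked_surface_trans:
  assumes "spacelike u"
  shows "crooked_surface ((ein_rho \<circ> ein_tau w \<circ> ein_rho) ` crooked_plane_conf z u)"
proof -
  define f where "f = ein_rho \<circ> ein_trans w \<circ> ein_rho \<circ> ein_trans z"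
  define g where "g = refl5 \<circ> trans5 w \<circ> refl5 \<circ> trans5 z"
  have lin: "linear g" unfolding g_def
    by (intro linear_compose linear_refl5 linear_trans5)
  have O: "matrix g \<in> O32"
    by (rule matrix_O32[OF lin]) (simp add: g_def form32_refl5 form32_trans5)
  \<comment> \<open>A translation is the square of the translation by half the vector, which
    excludes determinant -1.\<close>
  have det_trans: "det (matrix (trans5 v)) = 1" for v
  proof -
    have "trans5 v = trans5 ((1/2) *\<^sub>R v) \<circ> trans5 ((1/2) *\<^sub>R v)"
      by (auto simp: trans5_add simp flip: scaleR_add_left)
    then have "matrix (trans5 v) = matrix (trans5 ((1/2) *\<^sub>R v)) ** matrix (trans5 ((1/2) *\<^sub>R v))"
      by (metis matrix_compose linear_trans5)
    then show ?thesis
      using det_O32[OF matrix_O32[OF linear_trans5 form32_trans5]] by (simp add: det_mul)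
  qed
  \<comment> \<open>The reflection occurs twice, so its determinant enters as a square.\<close>
  have "matrix g = matrix refl5 ** matrix (trans5 w) ** matrix refl5 ** matrix (trans5 z)"
    unfolding g_def by (simp add: matrix_compose linear_compose linear_refl5 linear_trans5 matrix_mul_assoc)
  then have "det (matrix g) = 1"
    using det_O32[OF matrix_O32[OF linear_refl5 form32_refl5]]
    by (simp add: det_mul det_trans)
  then have "matrix g \<in> SO32" using O by (simp add: SO32_def)
  moreover have "matrix g *v X = g X" for X by (simp add: matrix_works lin)
  then have "induces (matrix g) f"
    by (simp add: induces_def f_def g_def ein_trans_proj ein_rho_proj
        refl5_null_cone32 trans5_null_cone32)
  moreover have "(ein_rho \<circ> ein_tau w \<circ> ein_rho) ` crooked_plane_conf z u = f ` crooked_plane_conf 0 u"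
    by (simp add: crooked_plane_conf_translate[OF assms, of z] f_def ein_tau_eq_trans image_comp o_assoc)
  ultimately show ?thesis using assms unfolding crooked_surface_def by blast
qed

lemma crooked_surface_cases:
  assumes "spacelike u" "q \<in> (ein_rho \<circ> ein_tau w \<circ> ein_rho) ` crooked_plane_conf z u"
  obtains X where "X \<in> side5 u" "q = ein_proj (refl5 (trans5 w (refl5 (trans5 z X))))"
proof -
  obtain p where p: "p \<in> crooked_plane_conf 0 u"
    "q = ein_rho (ein_trans w (ein_rho (ein_trans z p)))"
    using assms(2) by (auto simp: crooked_plane_conf_translate[OF assms(1), of z] ein_tau_eq_trans)
  obtain X where "X \<in> side5 u" "p = ein_proj X"
    using crooked_plane_conf_side5[OF assms(1) p(1)] by blast
  moreover from this have "X \<in> null_cone32" by (simp add: side5_def)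
  ultimately show ?thesis
    using that p(2) by (simp add: ein_trans_proj ein_rho_proj refl5_null_cone32 trans5_null_cone32)
qed

theorem theorem4p4:
  fixes u\<^sub>1 u\<^sub>2 z\<^sub>1 z\<^sub>2 z\<^sub>1' z\<^sub>2' :: "real^3"
  assumes "spacelike u\<^sub>1" and "spacelike u\<^sub>2"
    and "consistently_oriented u\<^sub>1 u\<^sub>2"
    and "(z\<^sub>1, z\<^sub>2) \<in> allowable_pairs u\<^sub>1 u\<^sub>2"
    and "(z\<^sub>1', z\<^sub>2') \<in> allowable_pairs u\<^sub>1 u\<^sub>2"
  shows "crooked_surface ((ein_rho \<circ> ein_tau z\<^sub>1' \<circ> ein_rho) ` crooked_plane_conf (0 + z\<^sub>1) u\<^sub>1)
    \<and> crooked_surface ((ein_rho \<circ> ein_tau z\<^sub>2' \<circ> ein_rho) ` crooked_plane_conf (0 + z\<^sub>2) u\<^sub>2)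
    \<and> (ein_rho \<circ> ein_tau z\<^sub>1' \<circ> ein_rho) ` crooked_plane_conf (0 + z\<^sub>1) u\<^sub>1
       \<inter> (ein_rho \<circ> ein_tau z\<^sub>2' \<circ> ein_rho) ` crooked_plane_conf (0 + z\<^sub>2) u\<^sub>2 = {}"
proof (intro conjI)
  note u = assms(1,2)
  show "crooked_surface ((ein_rho \<circ> ein_tau z\<^sub>1' \<circ> ein_rho) ` crooked_plane_conf (0 + z\<^sub>1) u\<^sub>1)"
    "crooked_surface ((ein_rho \<circ> ein_tau z\<^sub>2' \<circ> ein_rho) ` crooked_plane_conf (0 + z\<^sub>2) u\<^sub>2)"
    by (rule crooked_surface_trans, fact)+
  have disj: "closed_side u\<^sub>1 \<inter> closed_side u\<^sub>2 \<subseteq> {0}"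
    using assms(3) u[THEN closed_side_subset_closure] by (auto simp: consistently_oriented_def)
  have z: "z\<^sub>1 \<in> stem_quadrant 0 u\<^sub>1" "z\<^sub>2 \<in> stem_quadrant 0 u\<^sub>2"
    using assms(4) by (auto simp: allowable_pairs_def)
  have False
    if q: "q \<in> (ein_rho \<circ> ein_tau z\<^sub>1' \<circ> ein_rho) ` crooked_plane_conf (0 + z\<^sub>1) u\<^sub>1"
      "q \<in> (ein_rho \<circ> ein_tau z\<^sub>2' \<circ> ein_rho) ` crooked_plane_conf (0 + z\<^sub>2) u\<^sub>2" for q
  proof -
    let ?g = "\<lambda>w z X. refl5 (trans5 w (refl5 (trans5 z X)))"
    obtain X\<^sub>1 where X1: "X\<^sub>1 \<in> side5 u\<^sub>1" "q = ein_proj (?g z\<^sub>1' z\<^sub>1 X\<^sub>1)"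
      by (rule crooked_surface_cases[OF u(1) q(1)]) simp
    obtain X\<^sub>2 where X2: "X\<^sub>2 \<in> side5 u\<^sub>2" "q = ein_proj (?g z\<^sub>2' z\<^sub>2 X\<^sub>2)"
      by (rule crooked_surface_cases[OF u(2) q(2)]) simp
    have null: "X\<^sub>1 \<in> null_cone32" "X\<^sub>2 \<in> null_cone32" using X1(1) X2(1) by (simp_all add: side5_def)
    have "?g z\<^sub>1' z\<^sub>1 X\<^sub>1 \<in> null_cone32" "?g z\<^sub>2' z\<^sub>2 X\<^sub>2 \<in> null_cone32"
      using null by (simp_all add: refl5_null_cone32 trans5_null_cone32)
    then obtain t where t: "t \<noteq> 0" "?g z\<^sub>2' z\<^sub>2 X\<^sub>2 = t *\<^sub>R ?g z\<^sub>1' z\<^sub>1 X\<^sub>1"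
      using X1(2) X2(2) ein_proj_eq_iff by metis
    \<comment> \<open>Absorbing the projective factor turns an equality of points into an equality
      of vectors.\<close>
    define Y where "Y = t *\<^sub>R X\<^sub>1"
    have Y: "Y \<in> side5 u\<^sub>1" unfolding Y_def by (rule side5_scale[OF u(1) X1(1) t(1)])
    have "?g z\<^sub>1' z\<^sub>1 Y = ?g z\<^sub>2' z\<^sub>2 X\<^sub>2"
      by (simp add: Y_def t(2) linear_scale[OF linear_refl5] linear_scale[OF linear_trans5])
    then have eq: "trans5 z\<^sub>1' (refl5 (trans5 z\<^sub>1 Y)) = trans5 z\<^sub>2' (refl5 (trans5 z\<^sub>2 X\<^sub>2))"
      by (metis refl5_refl5)
    have U: "refl5 (trans5 z\<^sub>1 Y) \<in> side5 u\<^sub>1" "refl5 (trans5 z\<^sub>2 X\<^sub>2) \<in> side5 u\<^sub>2"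
      using u Y X2(1) z by (simp_all add: refl5_side5 trans5_side5)
    \<comment> \<open>The pair \<open>(z\<^sub>1', z\<^sub>2')\<close> identifies the reflected
      vectors; removing the reflection prepares the same argument for
      \<open>(z\<^sub>1, z\<^sub>2)\<close>.\<close>
    note at_inf = side5_translates_meet_at_infinity[OF u disj assms(5) U eq]
    have "trans5 z\<^sub>1 Y = trans5 z\<^sub>2 X\<^sub>2" using at_inf(3) by (metis refl5_refl5)
    note at_inf' = side5_translates_meet_at_infinity[OF u disj assms(4) Y X2(1) this]
    \<comment> \<open>Since \<open>lev Y\<close> and \<open>spat Y\<close> vanish, the translation
      by \<open>z\<^sub>1\<close> fixes \<open>Y\<close>. The first application thus kills the other
      light-cone coordinate too, and \<open>Y\<close> would be zero.\<close>
    have "lev (refl5 Y) = 0"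
      using at_inf(1) at_inf'(1,2) by (simp add: trans5_def)
    then have "Y$1 = 0" "Y$5 = 0" using at_inf'(1) by (simp_all add: lev_def)
    then show False
      using at_inf'(2) Y by (simp add: side5_def null_cone32_def vec_eq_5)
  qed
  then show "(ein_rho \<circ> ein_tau z\<^sub>1' \<circ> ein_rho) ` crooked_plane_conf (0 + z\<^sub>1) u\<^sub>1
       \<inter> (ein_rho \<circ> ein_tau z\<^sub>2' \<circ> ein_rho) ` crooked_plane_conf (0 + z\<^sub>2) u\<^sub>2 = {}"
    by blast
qed

end
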